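(* Suppose $(a,c)\in\Omega$, $m_{a,c}(t)\ge 0$ for all $t\ge 0$, and $m_{a,c}(t_0)=0$ at some $t_0>0$. Then $$\partial_a m_{a,c}(t_0)<0,\qquad \partial_c m_{a,c}(t_0)<0 .$$
   Context: $\Omega=\{(a,c): a>0,\ 0\le c<1,\ a+c<3\}$. For $(a,c)\in\Omega$ put $$w_{a,c}(s)=\frac1\pi\left(\frac{s}{1-s}\right)^{as+c}\sin\bigl(\pi(as+c)\bigr)\quad(0<s<1),$$ $$q_1=\frac a2+c,\qquad q_2=\frac a3+\frac c2+\frac12\left(\frac a2+c\right)^2,$$ $$D_{a,c}(t)=q_1+(q_1-q_2)t+e^{-a}\int_0^1 w_{a,c}(s)\bigl[e^{(1-s)t}-1-(1-s)t\bigr]\,ds,$$ and $m_{a,c}(t)=e^{-t}D_{a,c}(t)$. The derivative $\partial_c$ at $c=0$ is understood as the right derivative. *)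

theory Defs
  imports "HOL-Analysis.Analysis"
begin

definition Omega :: "(real \<times> real) set" where
  "Omega = {(a, c). 0 < a \<and> 0 \<le> c \<and> c < 1 \<and> a + c < 3}"

definition w :: "real \<Rightarrow> real \<Rightarrow> real \<Rightarrow> real" where
  "w a c s = 1 / pi * (s / (1 - s)) powr (a * s + c) * sin (pi * (a * s + c))"

definition q1 :: "real \<Rightarrow> real \<Rightarrow> real" where
  "q1 a c = a / 2 + c"

definition q2 :: "real \<Rightarrow> real \<Rightarrow> real" where
  "q2 a c = a / 3 + c / 2 + 1 / 2 * (a / 2 + c)\<^sup>2"

(* On Omega the integral converges absolutely: as s tends to 1 the weight is
   O((1-s) powr -(a+c)) while the bracket is O((1-s)^2), and a + c < 3.
   So the Lebesgue integral is the intended one and does not take its default value 0. *)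
definition D :: "real \<Rightarrow> real \<Rightarrow> real \<Rightarrow> real" where
  "D a c t = q1 a c + (q1 a c - q2 a c) * t
     + exp (- a) * (LBINT s:{0<..<1}. w a c s * (exp ((1 - s) * t) - 1 - (1 - s) * t))"

definition m :: "real \<Rightarrow> real \<Rightarrow> real \<Rightarrow> real" where
  "m a c t = exp (- t) * D a c t"

end

theory Submission
  imports Defs "HOL-Complex_Analysis.Cauchy_Integral_Formula"
begin

text \<open>Formally \<open>m a c t = e\<^sup>-\<^sup>a \<integral> w(s) e\<^sup>-\<^sup>s\<^sup>t ds\<close>. The weight \<open>e\<^sup>-\<^sup>a w\<close> is \<open>- 1/(2\<pi>i)\<close> times the jump across the slit \<open>[0, 1]\<close> of
\<open>E(y) = e\<^sup>-\<^sup>a exp (- (a y + c) Ln (1 - 1/y))\<close>, so collapsing a circle around the slit shows that \<open>m a c t\<close>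
is the contour integral \<open>J(e\<^sup>-\<^sup>t\<^sup>y)\<close>, where \<open>J(f) = 1/(2\<pi>i) \<oint> E f\<close> over \<open>|y| = 2\<close>. The
regularising terms in the definition of \<^const>\<open>D\<close> are accounted for by \<open>J(1) = q1\<close> and \<open>J(y) = q2\<close>
(\<open>m_eq_Re_laplace_w\<close>).

Away from the slit everything is smooth in all parameters. Put \<open>R\<^sub>t(s) = J(e\<^sup>-\<^sup>t\<^sup>y / (y - s))\<close> for \<open>s\<close> in
\<open>[0, 1]\<close>. Three logarithmic derivatives of \<open>E\<close> are Cauchy transforms of measures on the slit:
\<open>\<partial>E/\<partial>c\<close> gives the density \<open>1\<close>, \<open>\<partial>E/\<partial>a\<close> the density \<open>s\<close>, and \<open>\<partial>E/\<partial>y\<close> the measure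
\<open>a ds + c \<delta>\<^sub>0 - (a + c) \<delta>\<^sub>1\<close>. Hence \<open>\<partial>m/\<partial>c = \<integral> R\<^sub>t(s) ds\<close>, \<open>\<partial>m/\<partial>a = \<integral> s R\<^sub>t(s) ds\<close>, and, integrating by
parts, \<open>t m = a \<integral> R\<^sub>t + c R\<^sub>t(0) - (a + c) R\<^sub>t(1)\<close> (\<open>laplace_w_derivative_c\<close>, \<open>laplace_w_derivative_a\<close>,
\<open>laplace_w_resolvent_identity\<close>).

Since \<open>E \<rightarrow> 1\<close> at infinity, \<open>J(1 / (y - s)) = 1\<close>, and differentiating in \<open>t\<close> yields
\<open>e\<^sup>s\<^sup>t R\<^sub>t(s) = 1 - \<integral> e\<^sup>s\<^sup>u m(u) du\<close> over \<open>[0, t]\<close> (\<open>resolvent_Volterra\<close>). Because \<open>m \<ge> 0\<close> and \<open>m(0) = q1 > 0\<close>, the right-hand side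
decreases strictly in \<open>s\<close>; and at a zero \<open>t\<^sub>0\<close> of \<open>m\<close> the identity above is a linear balance between
\<open>\<integral> R\<close>, \<open>R(0)\<close> and \<open>R(1)\<close>. These two properties alone force \<open>\<integral> R < 0\<close> and \<open>\<integral> s R < 0\<close>
(\<open>sign_of_moments\<close>).\<close>

section \<open>The residue functional\<close>

text \<open>The function \<open>e\<^sup>-\<^sup>a (1 - 1/y) powr (- (a y + c))\<close>: it is holomorphic off the slit \<open>[0, 1]\<close>, has the
expansion \<open>1 + q1/y + q2/y\<^sup>2 + \<dots>\<close> at infinity, and jumps across the slit by \<open>- 2 \<pi> i e\<^sup>-\<^sup>a w\<close>.\<close>
definition genfun :: "real \<Rightarrow> real \<Rightarrow> complex \<Rightarrow> complex" where
  "genfun a c y = exp (- of_real a - (of_real a * y + of_real c) * Ln (1 - 1 / y))"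

definition circ :: "real \<Rightarrow> complex" where
  "circ \<theta> = 2 * cis \<theta>"

text \<open>In polar coordinates, this is \<open>1/(2\<pi>i)\<close> times the contour integral of \<open>genfun a c y * f y\<close> over the
circle \<open>|y| = 2\<close>. On \<^const>\<open>Omega\<close>, for an entire \<open>f\<close> vanishing doubly at \<open>1\<close>, the circle can be
collapsed onto the slit, giving \<open>e\<^sup>-\<^sup>a \<integral> w f\<close>; for other \<open>f\<close> it is the value that regularises this
integral, so no convergence condition at \<open>s = 1\<close> is left. The parametrised form makes differentiation
under the integral sign and Fubini directly applicable.\<close>
definition residue_functional :: "real \<Rightarrow> real \<Rightarrow> (complex \<Rightarrow> complex) \<Rightarrow> complex" where
  "residue_functional a c f =
     1 / (2 * pi) * integral {0..2 * pi} (\<lambda>\<theta>. genfun a c (circ \<theta>) * f (circ \<theta>) * circ \<theta>)"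

lemma one_minus_inverse_slit:
  fixes y :: complex
  assumes "y \<notin> of_real ` {0..1}"
  shows "1 - 1 / y \<notin> \<real>\<^sub>\<le>\<^sub>0"
proof
  assume "1 - 1 / y \<in> \<real>\<^sub>\<le>\<^sub>0"
  then obtain r where r: "1 - 1 / y = of_real r" "r \<le> 0"
    by (auto elim!: nonpos_Reals_cases)
  from r have y: "1 / y = of_real (1 - r)"
    by (simp add: algebra_simps)
  have "y = 1 / (1 / y)" by simp
  also have "\<dots> = of_real (1 / (1 - r))" unfolding y by simp
  finally have "y = of_real (1 / (1 - r))" .
  moreover have "1 / (1 - r) \<in> {0..1}" using r by auto
  ultimately show False using assms by blast
qed

lemma norm_circ [simp]: "norm (circ \<theta>) = 2"
  by (simp add: circ_def norm_mult)

lemma circ_nonzero [simp]: "circ \<theta> \<noteq> 0"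
  by (simp add: circ_def)

lemma norm_gt_1_off_slit:
  fixes y :: complex
  assumes "norm y > 1"
  shows "y \<notin> of_real ` {0..1}"
  using assms by auto

lemma norm_eq_2_minus_of_real_nonzero:
  fixes y :: complex
  assumes "norm y = 2" "s \<in> {0..1}"
  shows "y - of_real s \<noteq> 0" "y \<noteq> of_real s"
  using assms by auto

lemma circ_slit: "1 - 1 / circ \<theta> \<notin> \<real>\<^sub>\<le>\<^sub>0"
  by (rule one_minus_inverse_slit, rule norm_gt_1_off_slit) simp

lemma continuous_circ [continuous_intros]: "continuous_on A circ"
  unfolding circ_def by (intro continuous_intros)

lemma continuous_Ln_circ [continuous_intros]: "continuous_on A (\<lambda>\<theta>. Ln (1 - 1 / circ \<theta>))"
  by (intro continuous_intros) (auto simp: circ_slit)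

lemma continuous_genfun_circ [continuous_intros]: "continuous_on A (\<lambda>\<theta>. genfun a c (circ \<theta>))"
  unfolding genfun_def by (intro continuous_intros)

lemma continuous_circ_compose [continuous_intros]:
  assumes "continuous_on (sphere 0 2) f"
  shows "continuous_on A (\<lambda>\<theta>. f (circ \<theta>))"
  by (rule continuous_on_compose2[OF assms continuous_circ]) auto

lemma residue_functional_integrable:
  assumes "continuous_on (sphere 0 2) f"
  shows "(\<lambda>\<theta>. genfun a c (circ \<theta>) * f (circ \<theta>) * circ \<theta>) integrable_on {0..2 * pi}"
  by (intro integrable_continuous_real continuous_intros assms)

lemma residue_functional_cong:
  assumes "\<And>y. norm y = 2 \<Longrightarrow> f y = g y"
  shows "residue_functional a c f = residue_functional a c g"
  using assms by (simp add: residue_functional_def)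

lemma residue_functional_add:
  assumes "continuous_on (sphere 0 2) f" "continuous_on (sphere 0 2) g"
  shows "residue_functional a c (\<lambda>y. f y + g y) = residue_functional a c f + residue_functional a c g"
  unfolding residue_functional_def
  by (simp add: ring_distribs integral_add residue_functional_integrable assms)

lemma residue_functional_cmult:
  "residue_functional a c (\<lambda>y. k * f y) = k * residue_functional a c f"
proof -
  have "(\<lambda>\<theta>. genfun a c (circ \<theta>) * (k * f (circ \<theta>)) * circ \<theta>) =
     (\<lambda>\<theta>. k * (genfun a c (circ \<theta>) * f (circ \<theta>) * circ \<theta>))" by (simp add: algebra_simps)
  then show ?thesis unfolding residue_functional_def by simp
qed

lemma residue_functional_diff:
  assumes "continuous_on (sphere 0 2) f" "continuous_on (sphere 0 2) g"
  shows "residue_functional a c (\<lambda>y. f y - g y) = residue_functional a c f - residue_functional a c g"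
  unfolding residue_functional_def
  by (simp add: ring_distribs integral_diff residue_functional_integrable assms)

text \<open>Multiplication of \<open>f\<close> by the Cauchy transform of a density \<open>\<psi>\<close> on the slit is a superposition of the
elementary multiplications by \<open>1 / (y - s)\<close>. Factors \<open>Ln (1 - 1/y)\<close>, which are such transforms, are
resolved in this way.\<close>
lemma residue_functional_swap:
  fixes \<psi> :: "real \<Rightarrow> real"
  assumes f: "continuous_on (sphere 0 2) f" and psi: "continuous_on {0..1} \<psi>"
  shows "residue_functional a c (\<lambda>y. f y * integral {0..1} (\<lambda>s. of_real (\<psi> s) / (y - of_real s))) =
         integral {0..1} (\<lambda>s. of_real (\<psi> s) * residue_functional a c (\<lambda>y. f y / (y - of_real s)))"
proof -
  define G where "G \<theta> s = genfun a c (circ \<theta>) * (f (circ \<theta>) * (of_real (\<psi> s) / (circ \<theta> - of_real s))) * circ \<theta>"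
    for \<theta> s
  have G: "continuous_on (cbox (0, 0) (2 * pi, 1)) (\<lambda>(\<theta>, s). G \<theta> s)"
  proof -
    have "continuous_on ({0..2*pi} \<times> {0..1}) (\<lambda>p. G (fst p) (snd p))"
      unfolding G_def
      by (intro continuous_intros continuous_on_compose2[OF continuous_genfun_circ continuous_on_fst]
        continuous_on_compose2[OF continuous_circ continuous_on_fst]
        continuous_on_compose2[OF continuous_circ_compose[OF f] continuous_on_fst]
        continuous_on_compose2[OF psi continuous_on_snd])
       (auto simp: norm_eq_2_minus_of_real_nonzero)
    then show ?thesis by (simp add: cbox_Pair_eq case_prod_unfold)
  qed
  have "integral {0..2*pi} (\<lambda>\<theta>. integral {0..1} (G \<theta>)) =
        integral {0..1} (\<lambda>s. integral {0..2*pi} (\<lambda>\<theta>. G \<theta> s))"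
    using integral_swap_continuous[OF G] by simp
  moreover have "integral {0..1} (G \<theta>) = genfun a c (circ \<theta>) *
      (f (circ \<theta>) * integral {0..1} (\<lambda>s. of_real (\<psi> s) / (circ \<theta> - of_real s))) * circ \<theta>" for \<theta>
  proof -
    have "G \<theta> = (\<lambda>s. (genfun a c (circ \<theta>) * f (circ \<theta>) * circ \<theta>) * (of_real (\<psi> s) / (circ \<theta> - of_real s)))"
      unfolding G_def by (simp add: fun_eq_iff)
    then show ?thesis by (simp only: integral_mult_right) simp
  qed
  moreover have "integral {0..2*pi} (\<lambda>\<theta>. G \<theta> s) = of_real (\<psi> s) *
       integral {0..2*pi} (\<lambda>\<theta>. genfun a c (circ \<theta>) * (f (circ \<theta>) / (circ \<theta> - of_real s)) * circ \<theta>)" for s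
  proof -
    have "(\<lambda>\<theta>. G \<theta> s) = (\<lambda>\<theta>. of_real (\<psi> s) * (genfun a c (circ \<theta>) * (f (circ \<theta>) / (circ \<theta> - of_real s)) * circ \<theta>))"
      unfolding G_def by (simp add: field_simps)
    then show ?thesis by (simp only: integral_mult_right)
  qed
  ultimately have eq: "integral {0..2*pi} (\<lambda>\<theta>. genfun a c (circ \<theta>) *
      (f (circ \<theta>) * integral {0..1} (\<lambda>s. of_real (\<psi> s) / (circ \<theta> - of_real s))) * circ \<theta>) =
      integral {0..1} (\<lambda>s. of_real (\<psi> s) * integral {0..2*pi}
        (\<lambda>\<theta>. genfun a c (circ \<theta>) * (f (circ \<theta>) / (circ \<theta> - of_real s)) * circ \<theta>))"
    by simp
  have "(\<lambda>s. of_real (\<psi> s) * (1 / (2 * pi) * integral {0..2*pi}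
        (\<lambda>\<theta>. genfun a c (circ \<theta>) * (f (circ \<theta>) / (circ \<theta> - of_real s)) * circ \<theta>))) =
     (\<lambda>s. 1 / (2 * pi) * (of_real (\<psi> s) * integral {0..2*pi}
        (\<lambda>\<theta>. genfun a c (circ \<theta>) * (f (circ \<theta>) / (circ \<theta> - of_real s)) * circ \<theta>)))"
    by (simp add: algebra_simps)
  then show ?thesis
    unfolding residue_functional_def eq by simp
qed

lemma has_vector_derivative_Cauchy_kernel:
  assumes "norm y = 2" "s \<in> {0..1}"
  shows "((\<lambda>s. - Ln (1 - of_real s / y)) has_vector_derivative 1 / (y - of_real s)) (at s within {0..1})"
proof -
  have y: "y \<noteq> 0" using assms by auto
  have "norm (of_real s / y) \<le> 1 / 2" using assms by (simp add: norm_divide)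
  then have "Re (of_real s / y) \<le> 1/2"
    using complex_Re_le_cmod order_trans by blast
  then have n: "1 - of_real s / y \<notin> \<real>\<^sub>\<le>\<^sub>0"
    by (auto simp: complex_nonpos_Reals_iff)
  have "((\<lambda>s. - Ln (1 - s / y)) has_field_derivative 1 / (y - of_real s)) (at (of_real s))"
    using n y norm_eq_2_minus_of_real_nonzero[OF assms]
    by (auto intro!: derivative_eq_intros simp: divide_simps)
  from field_vector_diff_chain_within[OF has_vector_derivative_of_real[OF DERIV_ident]
      has_field_derivative_at_within[OF this], where S = "{0..1}"]
  show ?thesis by (simp add: o_def)
qed

lemma integral_Cauchy_kernel:
  assumes "norm y = 2"
  shows "integral {0..1} (\<lambda>s. 1 / (y - of_real s)) = - Ln (1 - 1 / y)"
  using fundamental_theorem_of_calculus[OF _ has_vector_derivative_Cauchy_kernel[OF assms]]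
  by (intro integral_unique) auto

lemma integral_Cauchy_kernel_moment:
  assumes "norm y = 2"
  shows "integral {0..1} (\<lambda>s. of_real s / (y - of_real s)) = - 1 - y * Ln (1 - 1 / y)"
proof -
  have "integral {0..1} (\<lambda>s. of_real s / (y - of_real s)) =
        integral {0..1} (\<lambda>s. y * (1 / (y - of_real s)) - 1)"
    using norm_eq_2_minus_of_real_nonzero[OF assms]
    by (intro integral_cong) (auto simp: divide_simps)
  also have "\<dots> = y * integral {0..1} (\<lambda>s. 1 / (y - of_real s)) - 1"
  proof (subst integral_diff)
    show "(\<lambda>s. y * (1 / (y - of_real s))) integrable_on {0..1::real}"
      by (intro integrable_continuous_real continuous_intros)
        (use norm_eq_2_minus_of_real_nonzero[OF assms] in auto)
  qed (simp_all only: integral_mult_right, auto)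
  finally show ?thesis by (simp add: integral_Cauchy_kernel[OF assms])
qed

text \<open>The logarithmic derivative is the Cauchy transform of the signed measure
\<open>a ds + c \<delta>\<^sub>0 - (a + c) \<delta>\<^sub>1\<close> on the slit, by \<open>integral_Cauchy_kernel\<close>.\<close>
lemma genfun_has_field_derivative:
  assumes y: "norm y = 2"
  shows "(genfun a c has_field_derivative
     genfun a c y * (- of_real a * Ln (1 - 1 / y) + of_real c / y - of_real (a + c) / (y - 1))) (at y)"
proof -
  have n: "1 - 1 / y \<notin> \<real>\<^sub>\<le>\<^sub>0" using y
    by (intro one_minus_inverse_slit norm_gt_1_off_slit) simp
  have nz: "y \<noteq> 0" "y - 1 \<noteq> 0" "1 - 1 / y \<noteq> 0" using y n by auto
  have "((\<lambda>y. 1 - 1 / y) has_field_derivative 1 / y\<^sup>2) (at y)"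
    using nz(1) by (auto intro!: derivative_eq_intros simp: power2_eq_square)
  from DERIV_chain2[OF has_field_derivative_Ln[OF n] this]
  have "((\<lambda>y. Ln (1 - 1 / y)) has_field_derivative 1 / (y * (y - 1))) (at y)"
    using nz by (simp add: field_simps power2_eq_square)
  then have "((\<lambda>y. - of_real a - (of_real a * y + of_real c) * Ln (1 - 1 / y)) has_field_derivative
      0 - ((of_real a * 1 + 0) * Ln (1 - 1 / y) + 1 / (y * (y - 1)) * (of_real a * y + of_real c))) (at y)"
    by (intro DERIV_diff DERIV_mult DERIV_add DERIV_cmult DERIV_const DERIV_ident)
  then have "((\<lambda>y. - of_real a - (of_real a * y + of_real c) * Ln (1 - 1 / y)) has_field_derivative
      - (of_real a * Ln (1 - 1 / y) + (of_real a * y + of_real c) * (1 / (y * (y - 1))))) (at y)"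
    by (simp add: mult_ac)
  from DERIV_fun_exp[OF this]
  have "(genfun a c has_field_derivative genfun a c y *
      - (of_real a * Ln (1 - 1 / y) + (of_real a * y + of_real c) * (1 / (y * (y - 1))))) (at y)"
    unfolding genfun_def .
  moreover have "(of_real a * y + of_real c) * (1 / (y * (y - 1))) =
      of_real (a + c) / (y - 1) - of_real c / y"
    using nz(1,2) by (simp add: divide_simps) (simp add: algebra_simps)
  then have "- (of_real a * Ln (1 - 1 / y) + (of_real a * y + of_real c) * (1 / (y * (y - 1)))) =
      - of_real a * Ln (1 - 1 / y) + of_real c / y - of_real (a + c) / (y - 1)"
    by (simp only:) simp
  ultimately show ?thesis by (simp only:)
qed

text \<open>The integral of \<open>(genfun a c f)'\<close> over a closed curve vanishes; the logarithmic derivative of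
\<^const>\<open>genfun\<close> supplies the right-hand side.\<close>
lemma residue_functional_by_parts:
  assumes f: "f holomorphic_on UNIV"
  shows "residue_functional a c (deriv f) =
      of_real (a + c) * residue_functional a c (\<lambda>y. f y / (y - 1)) - of_real c * residue_functional a c (\<lambda>y. f y / y)
       - of_real a * integral {0..1} (\<lambda>s. residue_functional a c (\<lambda>y. f y / (y - of_real s)))"
proof -
  \<comment> \<open>\<open>genfun a c * F'\<close> is the derivative of \<open>genfun a c * f\<close>.\<close>
  define F' where "F' y = deriv f y - f y * (of_real a * Ln (1 - 1 / y) - of_real c / y + of_real (a + c) / (y - 1))" for y
  have cf: "continuous_on A f" for A
    using f holomorphic_on_imp_continuous_on continuous_on_subset by blast
  have cdf: "continuous_on A (deriv f)" for A
    using holomorphic_deriv[OF f] holomorphic_on_imp_continuous_on continuous_on_subset by blast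
  have cLn: "continuous_on (sphere 0 2) (\<lambda>y::complex. Ln (1 - 1 / y))"
    by (intro continuous_intros) (auto intro!: one_minus_inverse_slit norm_gt_1_off_slit)
  have nz: "y \<noteq> 0" "y - 1 \<noteq> 0" if "y \<in> sphere 0 2" for y :: complex using that by auto
  have "((\<lambda>\<theta>. (genfun a c (circ \<theta>) * f (circ \<theta>))) has_vector_derivative
      \<i> * (genfun a c (circ \<theta>) * F' (circ \<theta>) * circ \<theta>)) (at \<theta> within {0..2*pi})" for \<theta>
  proof -
    have "((\<lambda>y. genfun a c y * f y) has_field_derivative genfun a c (circ \<theta>) * F' (circ \<theta>)) (at (circ \<theta>))"
      unfolding F'_def
      by (rule derivative_eq_intros genfun_has_field_derivative holomorphic_derivI[OF f] refl | simp)+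
        (simp add: algebra_simps)
    moreover have "(circ has_vector_derivative \<i> * circ \<theta>) (at \<theta> within {0..2*pi})"
      unfolding circ_def cis_conv_exp
      by (auto intro!: derivative_eq_intros has_vector_derivative_real_field simp: mult_ac)
    ultimately have "((\<lambda>y. genfun a c y * f y) \<circ> circ has_vector_derivative
        \<i> * circ \<theta> * (genfun a c (circ \<theta>) * F' (circ \<theta>))) (at \<theta> within {0..2*pi})"
      using field_vector_diff_chain_within has_field_derivative_at_within by blast
    then show ?thesis by (simp add: o_def mult_ac)
  qed
  then have "((\<lambda>\<theta>. \<i> * (genfun a c (circ \<theta>) * F' (circ \<theta>) * circ \<theta>)) has_integral
      (genfun a c (circ (2*pi)) * f (circ (2*pi)) - genfun a c (circ 0) * f (circ 0))) {0..2*pi}"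
    by (intro fundamental_theorem_of_calculus) auto
  then have "((\<lambda>\<theta>. \<i> * (genfun a c (circ \<theta>) * F' (circ \<theta>) * circ \<theta>)) has_integral 0) {0..2*pi}"
    by (simp add: circ_def)
  then have "integral {0..2*pi} (\<lambda>\<theta>. \<i> * (genfun a c (circ \<theta>) * F' (circ \<theta>) * circ \<theta>)) = 0"
    by (rule integral_unique)
  then have zero: "residue_functional a c F' = 0" by (simp add: residue_functional_def)
  have "residue_functional a c F' = residue_functional a c (\<lambda>y. ((deriv f y + of_real c * (f y / y)) - of_real (a + c) * (f y / (y - 1)))
      + of_real a * (f y * integral {0..1} (\<lambda>s. of_real 1 / (y - of_real s))))"
    by (rule residue_functional_cong) (simp add: F'_def integral_Cauchy_kernel algebra_simps)
  also have "\<dots> = residue_functional a c (deriv f) + of_real c * residue_functional a c (\<lambda>y. f y / y)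
     - of_real (a + c) * residue_functional a c (\<lambda>y. f y / (y - 1))
     + of_real a * residue_functional a c (\<lambda>y. f y * integral {0..1} (\<lambda>s. of_real 1 / (y - of_real s)))"
  proof -
    have "continuous_on (sphere 0 2) (\<lambda>y. f y * integral {0..1} (\<lambda>s. of_real 1 / (y - of_real s)))"
    proof (rule continuous_on_eq)
      show "continuous_on (sphere 0 2) (\<lambda>y. f y * - Ln (1 - 1 / y))"
        by (intro continuous_intros cf cLn)
    qed (simp add: integral_Cauchy_kernel)
    then show ?thesis using nz
      by (simp add: residue_functional_add residue_functional_diff residue_functional_cmult continuous_intros cf cdf
         del: times_divide_eq_right of_real_add)
  qed
  also have "residue_functional a c (\<lambda>y. f y * integral {0..1} (\<lambda>s. of_real 1 / (y - of_real s))) =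
     integral {0..1} (\<lambda>s. residue_functional a c (\<lambda>y. f y / (y - of_real s)))"
    using residue_functional_swap[OF cf, of "\<lambda>_. 1"] by simp
  finally have eq: "0 = residue_functional a c (deriv f) + of_real c * residue_functional a c (\<lambda>y. f y / y)
     - of_real (a + c) * residue_functional a c (\<lambda>y. f y / (y - 1))
     + of_real a * integral {0..1} (\<lambda>s. residue_functional a c (\<lambda>y. f y / (y - of_real s)))"
    unfolding zero .
  have "A = k * C - l * B - n * E" if "0 = A + l * B - k * C + n * E" for A B C E k l n :: complex
    using that by algebra
  from this[OF eq] show ?thesis .
qed

section \<open>Values on low powers and on Cauchy kernels\<close>

text \<open>In the coordinate \<open>z = 1/y\<close> the singularity at \<open>y = \<infinity>\<close> is removable with value \<open>1\<close>: the factor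
\<open>e\<^sup>-\<^sup>a\<close> cancels the limit of \<open>- (a / z) Ln (1 - z)\<close> in the exponent.\<close>
lemma genfun_inverse_holomorphic:
  "(\<lambda>z. if z = 0 then 1 else genfun a c (1 / z)) holomorphic_on ball 0 1"
proof (rule no_isolated_singularity[where K = "{0}"])
  let ?A = "\<lambda>z. if z = 0 then 1 else genfun a c (1 / z)"
  have n: "1 - z \<notin> \<real>\<^sub>\<le>\<^sub>0" if "z \<in> ball 0 1" for z :: complex
  proof -
    have "Re z < 1" using that complex_Re_le_cmod[of z] by simp
    then show ?thesis by (auto simp: complex_nonpos_Reals_iff)
  qed
  have "(\<lambda>z. exp (- of_real a - (of_real a * (1 / z) + of_real c) * Ln (1 - z))) holomorphic_on ball 0 1 - {0}"
    by (intro holomorphic_intros) (use n in auto)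
  then show hol: "?A holomorphic_on ball 0 1 - {0}"
    by (rule holomorphic_transform) (simp add: genfun_def)
  have "((\<lambda>z. Ln (1 - z)) has_field_derivative -1) (at (0::complex))"
    using n[of 0] by (auto intro!: derivative_eq_intros)
  then have L1: "((\<lambda>z. Ln (1 - z) / z) \<longlongrightarrow> -1) (at (0::complex))"
    by (simp add: has_field_derivative_iff)
  have L0: "((\<lambda>z::complex. Ln (1 - z)) \<longlongrightarrow> Ln (1 - 0)) (at 0)"
    using n[of 0] by (intro tendsto_intros) auto
  have "((\<lambda>z. exp (- of_real a - (of_real a * (Ln (1 - z) / z) + of_real c * Ln (1 - z)))) \<longlongrightarrow>
      exp (- of_real a - (of_real a * -1 + of_real c * Ln (1 - 0)))) (at (0::complex))"
    by (intro tendsto_intros L1 L0)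
  then have "((\<lambda>z. exp (- of_real a - (of_real a * (Ln (1 - z) / z) + of_real c * Ln (1 - z)))) \<longlongrightarrow> 1) (at (0::complex))"
    by simp
  then have "(?A \<longlongrightarrow> 1) (at 0)"
    by (rule Lim_transform_eventually)
      (auto simp: eventually_at_filter genfun_def ring_distribs)
  then have "isCont ?A 0" by (simp add: isCont_def)
  moreover have "isCont ?A z" if "z \<in> ball 0 1" "z \<noteq> 0" for z
    using continuous_on_eq_continuous_at[OF open_delete[OF open_ball]] that
      holomorphic_on_imp_continuous_on[OF hol] by blast
  ultimately have "isCont ?A z" if "z \<in> ball 0 1" for z
    using that by (cases "z = 0") simp_all
  then show "continuous_on (ball 0 1) ?A"
    by (intro continuous_at_imp_continuous_on) blast
qed auto

lemma integral_reverse_interval: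
  fixes f :: "real \<Rightarrow> 'a::euclidean_space"
  shows "integral {0..b} (\<lambda>x. f (b - x)) = integral {0..b} f"
proof -
  have "integral {0..b} f = integral {-b..-0} (\<lambda>x. f (- x))"
    by (rule Henstock_Kurzweil_Integration.integral_reflect_real[of b 0 f, symmetric])
  also have "\<dots> = integral {0 + -b..b + -b} (\<lambda>x. f (- x))" by simp
  also have "\<dots> = integral {0..b} (\<lambda>x. f (b - x))"
    using integral_shift_Icc_real[of 0 b "\<lambda>x. f (- x)" "-b"] by (simp add: o_def)
  finally show ?thesis by simp
qed

text \<open>After the substitution \<open>z = 1/y\<close> the integral becomes that of \<open>genfun a c (1/z) / (1 - s z) / z\<close> over
\<open>|z| = 1/2\<close>, so Cauchy's formula gives the value at \<open>z = 0\<close>.\<close>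
lemma residue_functional_Cauchy_kernel:
  assumes "s \<in> {0..1}"
  shows "residue_functional a c (\<lambda>y. 1 / (y - of_real s)) = 1"
proof -
  let ?A = "\<lambda>z. if z = 0 then 1 else genfun a c (1 / z)"
  let ?g = "\<lambda>\<theta>. genfun a c (circ \<theta>) * (1 / (circ \<theta> - of_real s)) * circ \<theta>"
  have nz: "1 - of_real s * z \<noteq> 0" if "z \<in> ball 0 1" for z :: complex
  proof
    assume "1 - of_real s * z = 0"
    then have "norm (of_real s * z) = 1" by (simp add: eq_diff_eq)
    moreover have "norm (of_real s * z) \<le> 1 * norm z"
      unfolding norm_mult using assms by (intro mult_right_mono) auto
    ultimately show False using that by simp
  qed
  have "(\<lambda>z. ?A z / (1 - of_real s * z)) holomorphic_on ball 0 1"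
    using nz by (intro holomorphic_intros genfun_inverse_holomorphic) auto
  then have "((\<lambda>z. ?A z / (1 - of_real s * z) / (z - 0)) has_contour_integral
     2 * of_real pi * \<i> * (?A 0 / (1 - of_real s * 0))) (circlepath 0 (1/2))"
    by (intro Cauchy_integral_circlepath_simple holomorphic_on_subset[where t = "cball 0 (1/2)"]) auto
  then have "contour_integral (part_circlepath 0 (1/2) 0 (2 * pi)) (\<lambda>z. ?A z / (1 - of_real s * z) / z) = 2 * of_real pi * \<i>"
    using contour_integral_unique by (fastforce simp: circlepath_def)
  moreover have "contour_integral (part_circlepath 0 (1/2) 0 (2 * pi)) (\<lambda>z. ?A z / (1 - of_real s * z) / z)
     = integral {0..2*pi} (\<lambda>t. \<i> * ?g (2 * pi - t))"
  proof (subst contour_integral_part_circlepath_eq)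
    have e: "circ (2 * pi - t) = 2 * cis (- t)" for t
      unfolding circ_def by (metis cis_mult cis_2pi mult_1 diff_conv_add_uminus)
    have "1 / (cis t / 2) = circ (2 * pi - t)" for t
    proof -
      have "1 / (cis t / 2) = 2 * inverse (cis t)"
        by (simp only: divide_divide_eq_right) (simp only: divide_inverse mult_1)
      then show ?thesis unfolding e cis_inverse .
    qed
    then have "cis t / 2 = 1 / circ (2 * pi - t)" for t
      by (metis divide_divide_eq_right mult_1 div_by_1)
    then have e2: "1 / 2 * cis t = 1 / circ (2 * pi - t)" for t by simp
    show "integral {0..2*pi} (\<lambda>t. ?A (0 + of_real (1/2) * cis t) / (1 - of_real s * (0 + of_real (1/2) * cis t)) /
       (0 + of_real (1/2) * cis t) * of_real (1/2) * \<i> * cis t) = integral {0..2*pi} (\<lambda>t. \<i> * ?g (2 * pi - t))"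
    proof (rule integral_cong)
      fix t
      define y where "y = circ (2 * pi - t)"
      have y: "y \<noteq> 0" "y - of_real s \<noteq> 0"
        unfolding y_def using norm_eq_2_minus_of_real_nonzero[OF _ assms] by auto
      have "?A (0 + of_real (1/2) * cis t) / (1 - of_real s * (0 + of_real (1/2) * cis t)) /
       (0 + of_real (1/2) * cis t) * of_real (1/2) * \<i> * cis t =
         \<i> * (genfun a c y / (1 - of_real s * (1 / y)))"
      proof -
        have z: "0 + of_real (1/2) * cis t = 1 / y"
          using e2[of t] by (simp add: y_def)
        have fac: "X * of_real (1/2) * \<i> * cis t = X * \<i> * (1 / y)" for X
          unfolding z[symmetric] by simp
        show ?thesis unfolding fac z using y(1) by simp
      qed
      also have "\<dots> = \<i> * ?g (2 * pi - t)"
        unfolding y_def[symmetric] using y by (simp add: divide_simps)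
      finally show "?A (0 + of_real (1/2) * cis t) / (1 - of_real s * (0 + of_real (1/2) * cis t)) /
       (0 + of_real (1/2) * cis t) * of_real (1/2) * \<i> * cis t = \<i> * ?g (2 * pi - t)" .
    qed
  qed simp
  moreover have "integral {0..2*pi} (\<lambda>t. \<i> * ?g (2 * pi - t)) = \<i> * integral {0..2*pi} ?g"
    by (simp only: integral_mult_right integral_reverse_interval[of "2*pi" ?g])
  ultimately have "\<i> * integral {0..2*pi} ?g = 2 * of_real pi * \<i>"
    by (simp only:)
  then show ?thesis by (simp add: residue_functional_def)
qed

text \<open>The two point masses of the logarithmic derivative sit at the ends of the slit, so a formula for
\<open>f y / (y - s)\<close> that is uniform in \<open>s\<close> provides all three terms of \<open>residue_functional_by_parts\<close>.\<close>
lemma residue_functional_by_parts_kernel: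
  assumes f: "f holomorphic_on UNIV"
    and G: "\<And>s. s \<in> {0..1} \<Longrightarrow> residue_functional a c (\<lambda>y. f y / (y - of_real s)) = G s"
  shows "residue_functional a c (deriv f) =
      of_real (a + c) * G 1 - of_real c * G 0 - of_real a * integral {0..1} G"
  using residue_functional_by_parts[OF f, of a c] G[of 0] G[of 1]
    integral_cong[of "{0..1}" "\<lambda>s. residue_functional a c (\<lambda>y. f y / (y - of_real s))" G] G
  by simp

lemma integral_quadratic_complex:
  "integral {0..1} (\<lambda>s. K + L * of_real s + M * of_real s ^ 2) = K + L / 2 + M / (3::complex)"
proof -
  have "((\<lambda>s. K + L * of_real s + M * of_real s ^ 2) has_integral
      (K * of_real 1 + L / 2 * of_real 1 ^ 2 + M / 3 * of_real 1 ^ 3) -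
      (K * of_real 0 + L / 2 * of_real 0 ^ 2 + M / 3 * of_real 0 ^ 3)) {0..1}"
    by (intro fundamental_theorem_of_calculus has_vector_derivative_real_field)
      (auto intro!: derivative_eq_intros)
  then show ?thesis by (auto dest: integral_unique)
qed

text \<open>Both moments come out of integration by parts, with \<open>f y = y\<close> and \<open>f y = y\<^sup>2\<close>: polynomial division by
\<open>y - s\<close> expresses the right-hand side through the unknown moment itself, whose coefficients cancel
on that side.\<close>
lemma residue_functional_one: "residue_functional a c (\<lambda>y. 1) = of_real (q1 a c)"
proof -
  let ?m = "residue_functional a c (\<lambda>y. 1)"
  have G: "residue_functional a c (\<lambda>y. y / (y - of_real s)) = ?m + 1 * of_real s + 0 * of_real s ^ 2"
    if s: "s \<in> {0..1}" for s
  proof -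
    note nz = norm_eq_2_minus_of_real_nonzero[OF _ s]
    have "residue_functional a c (\<lambda>y. y / (y - of_real s)) =
       residue_functional a c (\<lambda>y. 1 + of_real s * (1 / (y - of_real s)))"
      using nz by (intro residue_functional_cong) (auto simp: divide_simps)
    also have "\<dots> = ?m + of_real s * residue_functional a c (\<lambda>y. 1 / (y - of_real s))"
      unfolding residue_functional_cmult[symmetric]
      by (rule residue_functional_add) (auto intro!: continuous_intros simp: nz)
    finally show ?thesis by (simp add: residue_functional_Cauchy_kernel[OF s])
  qed
  have "?m = of_real (a + c) * (?m + 1 * of_real 1 + 0 * of_real 1 ^ 2)
     - of_real c * (?m + 1 * of_real 0 + 0 * of_real 0 ^ 2) - of_real a * (?m + 1 / 2 + 0 / 3)"
    using residue_functional_by_parts_kernel[of "\<lambda>y. y" a c, OF _ G] unfolding integral_quadratic_complex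
    by simp
  also have "\<dots> = of_real a / 2 + of_real c" by (simp add: field_simps)
  finally show ?thesis by (simp add: q1_def)
qed

lemma residue_functional_id: "residue_functional a c (\<lambda>y. y) = of_real (q2 a c)"
proof -
  let ?m = "residue_functional a c (\<lambda>y. y)" and ?q = "of_real (q1 a c) :: complex"
  have G: "residue_functional a c (\<lambda>y. y\<^sup>2 / (y - of_real s)) = ?m + ?q * of_real s + 1 * of_real s ^ 2"
    if s: "s \<in> {0..1}" for s
  proof -
    note nz = norm_eq_2_minus_of_real_nonzero[OF _ s]
    have "residue_functional a c (\<lambda>y. y\<^sup>2 / (y - of_real s)) =
       residue_functional a c (\<lambda>y. (y + of_real s * 1) + of_real s ^ 2 * (1 / (y - of_real s)))"
      using nz by (intro residue_functional_cong) (auto simp: divide_simps power2_eq_square algebra_simps)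
    also have "\<dots> = residue_functional a c (\<lambda>y. y + of_real s * 1) + of_real s ^ 2 * residue_functional a c (\<lambda>y. 1 / (y - of_real s))"
      unfolding residue_functional_cmult[symmetric]
      by (rule residue_functional_add) (auto intro!: continuous_intros simp: nz)
    also have "residue_functional a c (\<lambda>y. y + of_real s * 1) = ?m + of_real s * residue_functional a c (\<lambda>y. 1)"
      unfolding residue_functional_cmult[symmetric]
      by (rule residue_functional_add) (auto intro!: continuous_intros)
    finally show ?thesis by (simp add: residue_functional_Cauchy_kernel[OF s] residue_functional_one)
  qed
  have "deriv (\<lambda>y. y\<^sup>2) = (\<lambda>y::complex. 2 * y)"
    by (rule ext, rule DERIV_imp_deriv) (auto intro!: derivative_eq_intros)
  then have "2 * ?m = of_real (a + c) * (?m + ?q * of_real 1 + 1 * of_real 1 ^ 2)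
     - of_real c * (?m + ?q * of_real 0 + 1 * of_real 0 ^ 2) - of_real a * (?m + ?q / 2 + 1 / 3)"
    using residue_functional_by_parts_kernel[of "\<lambda>y. y\<^sup>2" a c, OF _ G] unfolding integral_quadratic_complex
    by (simp add: residue_functional_cmult holomorphic_on_power)
  then have "2 * ?m = ?q * (of_real a / 2 + of_real c) + 2 / 3 * of_real a + of_real c"
    by (simp add: field_simps)
  then have "2 * ?m / 2 = (?q * (of_real a / 2 + of_real c) + 2 / 3 * of_real a + of_real c) / 2"
    by (simp only:)
  then have "?m = (?q * (of_real a / 2 + of_real c) + 2 / 3 * of_real a + of_real c) / 2"
    by simp
  also have "\<dots> = of_real ((q1 a c * (a / 2 + c) + 2 / 3 * a + c) / 2)"
    by simp
  also have "(q1 a c * (a / 2 + c) + 2 / 3 * a + c) / 2 = q2 a c"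
    unfolding q1_def q2_def by (simp add: field_simps power2_eq_square)
  finally show ?thesis .
qed

section \<open>Parameter derivatives and the Volterra equation\<close>

text \<open>The parameters \<open>a\<close>, \<open>c\<close> and \<open>t\<close> all enter the integrands linearly in an exponent, so this one instance
of the Leibniz rule serves the three of them.\<close>
lemma integral_exp_family_derivative:
  fixes \<alpha> \<beta> \<gamma> :: "real \<Rightarrow> complex"
  assumes "continuous_on {p..q} \<alpha>" "continuous_on {p..q} \<beta>" "continuous_on {p..q} \<gamma>"
  shows "((\<lambda>x. integral {p..q} (\<lambda>\<theta>. exp (\<alpha> \<theta> + of_real x * \<beta> \<theta>) * \<gamma> \<theta>)) has_vector_derivative
     integral {p..q} (\<lambda>\<theta>. exp (\<alpha> \<theta> + of_real x * \<beta> \<theta>) * \<beta> \<theta> * \<gamma> \<theta>)) (at x)"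
proof -
  have "continuous_on (UNIV \<times> {p..q}) (\<lambda>z. exp (\<alpha> (snd z) + of_real (fst z) * \<beta> (snd z)) * \<beta> (snd z) * \<gamma> (snd z))"
    by (intro continuous_intros continuous_on_compose2[OF assms(1) continuous_on_snd]
        continuous_on_compose2[OF assms(2) continuous_on_snd]
        continuous_on_compose2[OF assms(3) continuous_on_snd]) auto
  then have cont: "continuous_on (UNIV \<times> cbox p q) (\<lambda>(x, \<theta>). exp (\<alpha> \<theta> + of_real x * \<beta> \<theta>) * \<beta> \<theta> * \<gamma> \<theta>)"
    by (simp add: case_prod_unfold)
  have "((\<lambda>x. integral (cbox p q) (\<lambda>\<theta>. exp (\<alpha> \<theta> + of_real x * \<beta> \<theta>) * \<gamma> \<theta>)) has_vector_derivative
     integral (cbox p q) (\<lambda>\<theta>. exp (\<alpha> \<theta> + of_real x * \<beta> \<theta>) * \<beta> \<theta> * \<gamma> \<theta>)) (at x within UNIV)"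
  proof (rule leibniz_rule_vector_derivative[OF _ _ cont])
    fix x \<theta>
    have "((\<lambda>x. exp (\<alpha> \<theta> + x * \<beta> \<theta>) * \<gamma> \<theta>) has_field_derivative exp (\<alpha> \<theta> + of_real x * \<beta> \<theta>) * \<beta> \<theta> * \<gamma> \<theta>) (at (of_real x))"
      by (auto intro!: derivative_eq_intros)
    then show "((\<lambda>x. exp (\<alpha> \<theta> + of_real x * \<beta> \<theta>) * \<gamma> \<theta>) has_vector_derivative
       exp (\<alpha> \<theta> + of_real x * \<beta> \<theta>) * \<beta> \<theta> * \<gamma> \<theta>) (at x within UNIV)"
      by (rule has_vector_derivative_real_field)
  next
    fix x :: real
    show "(\<lambda>\<theta>. exp (\<alpha> \<theta> + of_real x * \<beta> \<theta>) * \<gamma> \<theta>) integrable_on cbox p q"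
      unfolding box_real by (intro integrable_continuous_real continuous_intros assms)
  qed auto
  then show ?thesis by simp
qed

text \<open>The function \<open>m a c t\<close> without its regularising terms: formally \<open>e\<^sup>-\<^sup>a \<integral> w(s) e\<^sup>-\<^sup>s\<^sup>t ds\<close>.\<close>
definition laplace_w :: "real \<Rightarrow> real \<Rightarrow> real \<Rightarrow> complex" where
  "laplace_w a c t = residue_functional a c (\<lambda>y. exp (- (of_real t * y)))"

definition resolvent :: "real \<Rightarrow> real \<Rightarrow> real \<Rightarrow> real \<Rightarrow> complex" where
  "resolvent a c t s = residue_functional a c (\<lambda>y. exp (- (of_real t * y)) / (y - of_real s))"

text \<open>Differentiation in \<open>a\<close> multiplies \<^const>\<open>genfun\<close> by \<open>- 1 - y Ln (1 - 1/y)\<close>, the Cauchy transform of the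
density \<open>s\<close> on the slit.\<close>
lemma laplace_w_derivative_a:
  "((\<lambda>x. laplace_w x c t) has_vector_derivative
      integral {0..1} (\<lambda>s. of_real s * resolvent a c t s)) (at a)"
proof -
  let ?L = "\<lambda>\<theta>. Ln (1 - 1 / circ \<theta>)"
  let ?I = "\<lambda>x. integral {0..2*pi} (\<lambda>\<theta>. exp ((- (of_real t * circ \<theta>) - of_real c * ?L \<theta>)
         + of_real x * (- 1 - circ \<theta> * ?L \<theta>)) * circ \<theta>)"
  let ?I' = "integral {0..2*pi} (\<lambda>\<theta>. exp ((- (of_real t * circ \<theta>) - of_real c * ?L \<theta>)
         + of_real a * (- 1 - circ \<theta> * ?L \<theta>)) * (- 1 - circ \<theta> * ?L \<theta>) * circ \<theta>)"
  have "(?I has_vector_derivative ?I') (at a)"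
    by (rule integral_exp_family_derivative[where \<alpha> = "\<lambda>\<theta>. - (of_real t * circ \<theta>) - of_real c * ?L \<theta>"
        and \<beta> = "\<lambda>\<theta>. - 1 - circ \<theta> * ?L \<theta>" and \<gamma> = circ]) (intro continuous_intros)+
  then have "((\<lambda>x. of_real (1 / (2*pi)) * ?I x) has_vector_derivative of_real (1 / (2*pi)) * ?I') (at a)"
    by (rule has_vector_derivative_mult_right)
  moreover have "of_real (1 / (2*pi)) * ?I x = laplace_w x c t" for x
    unfolding laplace_w_def residue_functional_def genfun_def exp_add[symmetric] by (simp add: algebra_simps)
  moreover have "of_real (1 / (2*pi)) * ?I' = residue_functional a c (\<lambda>y. exp (- (of_real t * y)) * (- 1 - y * Ln (1 - 1 / y)))"
  proof -
    have "exp ((- (of_real t * circ \<theta>) - of_real c * ?L \<theta>)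
         + of_real a * (- 1 - circ \<theta> * ?L \<theta>)) = genfun a c (circ \<theta>) * exp (- (of_real t * circ \<theta>))" for \<theta>
      unfolding genfun_def exp_add[symmetric] by (simp add: algebra_simps)
    then show ?thesis unfolding residue_functional_def by (simp add: mult.assoc)
  qed
  moreover have "residue_functional a c (\<lambda>y. exp (- (of_real t * y)) * (- 1 - y * Ln (1 - 1 / y))) =
     residue_functional a c (\<lambda>y. exp (- (of_real t * y)) * integral {0..1} (\<lambda>s. of_real s / (y - of_real s)))"
    by (rule residue_functional_cong) (simp add: integral_Cauchy_kernel_moment)
  moreover have "\<dots> = integral {0..1} (\<lambda>s. of_real s * resolvent a c t s)"
    unfolding resolvent_def by (intro residue_functional_swap continuous_intros)
  ultimately show ?thesis by simp
qed

text \<open>Differentiation in \<open>c\<close> multiplies \<^const>\<open>genfun\<close> by \<open>- Ln (1 - 1/y)\<close>, the Cauchy transform of the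
density \<open>1\<close>.\<close>
lemma laplace_w_derivative_c:
  "((\<lambda>x. laplace_w a x t) has_vector_derivative integral {0..1} (\<lambda>s. resolvent a c t s)) (at c)"
proof -
  let ?L = "\<lambda>\<theta>. Ln (1 - 1 / circ \<theta>)"
  let ?I = "\<lambda>x. integral {0..2*pi} (\<lambda>\<theta>. exp ((- (of_real t * circ \<theta>) + of_real a * (- 1 - circ \<theta> * ?L \<theta>))
         + of_real x * (- ?L \<theta>)) * circ \<theta>)"
  let ?I' = "integral {0..2*pi} (\<lambda>\<theta>. exp ((- (of_real t * circ \<theta>) + of_real a * (- 1 - circ \<theta> * ?L \<theta>))
         + of_real c * (- ?L \<theta>)) * (- ?L \<theta>) * circ \<theta>)"
  have "(?I has_vector_derivative ?I') (at c)"
    by (rule integral_exp_family_derivative[where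
        \<alpha> = "\<lambda>\<theta>. - (of_real t * circ \<theta>) + of_real a * (- 1 - circ \<theta> * ?L \<theta>)"
        and \<beta> = "\<lambda>\<theta>. - ?L \<theta>" and \<gamma> = circ]) (intro continuous_intros)+
  then have "((\<lambda>x. of_real (1 / (2*pi)) * ?I x) has_vector_derivative of_real (1 / (2*pi)) * ?I') (at c)"
    by (rule has_vector_derivative_mult_right)
  moreover have "of_real (1 / (2*pi)) * ?I x = laplace_w a x t" for x
    unfolding laplace_w_def residue_functional_def genfun_def exp_add[symmetric] by (simp add: algebra_simps)
  moreover have "of_real (1 / (2*pi)) * ?I' = residue_functional a c (\<lambda>y. exp (- (of_real t * y)) * - Ln (1 - 1 / y))"
  proof -
    have "exp ((- (of_real t * circ \<theta>) + of_real a * (- 1 - circ \<theta> * ?L \<theta>))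
         + of_real c * (- ?L \<theta>)) = genfun a c (circ \<theta>) * exp (- (of_real t * circ \<theta>))" for \<theta>
      unfolding genfun_def exp_add[symmetric] by (simp add: algebra_simps)
    then show ?thesis unfolding residue_functional_def by (simp add: mult.assoc)
  qed
  moreover have "residue_functional a c (\<lambda>y. exp (- (of_real t * y)) * - Ln (1 - 1 / y)) =
     residue_functional a c (\<lambda>y. exp (- (of_real t * y)) * integral {0..1} (\<lambda>s. of_real 1 / (y - of_real s)))"
    by (rule residue_functional_cong) (simp add: integral_Cauchy_kernel)
  moreover have "\<dots> = integral {0..1} (\<lambda>s. of_real 1 * resolvent a c t s)"
    unfolding resolvent_def by (intro residue_functional_swap continuous_intros)
  ultimately show ?thesis by simp
qed

text \<open>Integration by parts with \<open>f y = e\<^sup>-\<^sup>t\<^sup>y\<close>.\<close>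
lemma laplace_w_resolvent_identity:
  "of_real t * laplace_w a c t = of_real a * integral {0..1} (\<lambda>s. resolvent a c t s)
     + of_real c * resolvent a c t 0 - of_real (a + c) * resolvent a c t 1"
proof -
  have "deriv (\<lambda>y. exp (- (of_real t * y))) = (\<lambda>y::complex. - of_real t * exp (- (of_real t * y)))"
    by (rule ext, rule DERIV_imp_deriv) (auto intro!: derivative_eq_intros)
  moreover have "residue_functional a c (deriv (\<lambda>y. exp (- (of_real t * y)))) =
      of_real (a + c) * resolvent a c t 1 - of_real c * resolvent a c t 0
       - of_real a * integral {0..1} (resolvent a c t)"
    by (rule residue_functional_by_parts_kernel) (auto simp: resolvent_def intro!: holomorphic_intros)
  ultimately have "- of_real t * laplace_w a c t = of_real (a + c) * resolvent a c t 1 - of_real c * resolvent a c t 0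
       - of_real a * integral {0..1} (resolvent a c t)"
    by (simp only: laplace_w_def residue_functional_cmult)
  then show ?thesis by (simp add: algebra_simps)
qed

lemma continuous_laplace_w: "continuous_on A (laplace_w a c)"
proof -
  have "continuous_on (UNIV \<times> {0..2*pi}) (\<lambda>z. genfun a c (circ (snd z)) * exp (- (of_real (fst z) * circ (snd z))) * circ (snd z))"
    by (intro continuous_intros continuous_on_compose2[OF continuous_genfun_circ continuous_on_snd]
        continuous_on_compose2[OF continuous_circ continuous_on_snd]) auto
  then have "continuous_on UNIV (\<lambda>t. integral (cbox 0 (2*pi)) (\<lambda>\<theta>. genfun a c (circ \<theta>) * exp (- (of_real t * circ \<theta>)) * circ \<theta>))"
    by (intro integral_continuous_on_param) (simp add: case_prod_unfold)
  then have "continuous_on UNIV (laplace_w a c)"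
    unfolding laplace_w_def[abs_def] residue_functional_def by (intro continuous_intros) simp
  then show ?thesis by (rule continuous_on_subset) simp
qed

text \<open>The \<open>t\<close>-derivative of \<open>e\<^sup>s\<^sup>t e\<^sup>-\<^sup>t\<^sup>y / (y - s)\<close> is \<open>- e\<^sup>s\<^sup>t e\<^sup>-\<^sup>t\<^sup>y\<close>: the pole cancels. The initial value
is \<open>residue_functional_Cauchy_kernel\<close>.\<close>
lemma resolvent_Volterra:
  assumes s: "s \<in> {0..1}" and t: "0 \<le> t"
  shows "exp (of_real (s * t)) * resolvent a c t s = 1 - integral {0..t} (\<lambda>u. exp (of_real (s * u)) * laplace_w a c u)"
proof -
  note nz = norm_eq_2_minus_of_real_nonzero[OF norm_circ s]
  define N where "N u = exp (of_real (s * u)) * resolvent a c u s" for u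
  let ?I = "\<lambda>x. integral {0..2*pi} (\<lambda>\<theta>. exp ((- of_real a - (of_real a * circ \<theta> + of_real c) * Ln (1 - 1 / circ \<theta>))
         + of_real x * (of_real s - circ \<theta>)) * (circ \<theta> / (circ \<theta> - of_real s)))"
  let ?I' = "\<lambda>x. integral {0..2*pi} (\<lambda>\<theta>. exp ((- of_real a - (of_real a * circ \<theta> + of_real c) * Ln (1 - 1 / circ \<theta>))
         + of_real x * (of_real s - circ \<theta>)) * (of_real s - circ \<theta>) * (circ \<theta> / (circ \<theta> - of_real s)))"
  have e: "exp ((- of_real a - (of_real a * circ \<theta> + of_real c) * Ln (1 - 1 / circ \<theta>)) + of_real u * (of_real s - circ \<theta>))
      = genfun a c (circ \<theta>) * (exp (of_real (s * u)) * exp (- (of_real u * circ \<theta>)))" for u \<theta>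
    unfolding genfun_def exp_add[symmetric] by (simp add: algebra_simps)
  have "of_real (1 / (2*pi)) * ?I u = N u" for u
    unfolding N_def resolvent_def residue_functional_cmult[symmetric]
    unfolding residue_functional_def e by (simp add: algebra_simps)
  moreover have "of_real (1 / (2*pi)) * ?I' u = - (exp (of_real (s * u)) * laplace_w a c u)" for u
  proof -
    have "(of_real s - circ \<theta>) * (circ \<theta> / (circ \<theta> - of_real s)) = - circ \<theta>" for \<theta>
      using nz by (simp add: divide_simps) (simp add: algebra_simps)
    then have "?I' u = integral {0..2*pi} (\<lambda>\<theta>. genfun a c (circ \<theta>) * (- (exp (of_real (s * u))) * exp (- (of_real u * circ \<theta>))) * circ \<theta>)"
      unfolding e mult.assoc by simp
    then have "of_real (1 / (2*pi)) * ?I' u = residue_functional a c (\<lambda>y. - (exp (of_real (s * u))) * exp (- (of_real u * y)))"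
      unfolding residue_functional_def by simp
    then show ?thesis unfolding laplace_w_def residue_functional_cmult by simp
  qed
  moreover have "((\<lambda>x. of_real (1 / (2*pi)) * ?I x) has_vector_derivative of_real (1 / (2*pi)) * ?I' u) (at u)" for u
    by (rule has_vector_derivative_mult_right, rule integral_exp_family_derivative[where
        \<alpha> = "\<lambda>\<theta>. - of_real a - (of_real a * circ \<theta> + of_real c) * Ln (1 - 1 / circ \<theta>)"
        and \<beta> = "\<lambda>\<theta>. of_real s - circ \<theta>" and \<gamma> = "\<lambda>\<theta>. circ \<theta> / (circ \<theta> - of_real s)"])
      (intro continuous_intros ballI nz)+
  ultimately have "(N has_vector_derivative - (exp (of_real (s * u)) * laplace_w a c u)) (at u within {0..t})" for u
    by (simp add: has_vector_derivative_at_within)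
  then have "((\<lambda>u. - (exp (of_real (s * u)) * laplace_w a c u)) has_integral N t - N 0) {0..t}"
    using t by (intro fundamental_theorem_of_calculus)
  then have "- integral {0..t} (\<lambda>u. exp (of_real (s * u)) * laplace_w a c u) = N t - N 0"
    by (metis integral_neg integral_unique)
  moreover have "N 0 = 1" by (simp add: N_def resolvent_def residue_functional_Cauchy_kernel[OF s])
  ultimately show ?thesis by (simp add: N_def algebra_simps)
qed

section \<open>Collapsing the circle onto the slit\<close>

lemma genfun_cnj:
  assumes "1 - 1 / y \<notin> \<real>\<^sub>\<le>\<^sub>0"
  shows "genfun a c (cnj y) = cnj (genfun a c y)"
  using cnj_Ln[OF assms] by (simp add: genfun_def exp_cnj)

lemma circ_reflect: "circ (2 * pi - t) = cnj (circ t)"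
proof -
  have "cis (2 * pi - t) = cis (- t)"
    by (metis cis_mult cis_2pi mult_1 diff_conv_add_uminus)
  then show ?thesis by (simp add: circ_def cis_cnj)
qed

text \<open>By conjugation symmetry the two half circles contribute the same real part.\<close>
lemma Re_residue_functional_eq_upper_arc:
  assumes f: "continuous_on (sphere 0 2) f" and sym: "\<And>y. f (cnj y) = cnj (f y)"
  shows "Re (residue_functional a c f) =
     Im (contour_integral (part_circlepath 0 2 0 pi) (\<lambda>y. genfun a c y * f y)) / pi"
proof -
  define g where "g \<theta> = genfun a c (circ \<theta>) * f (circ \<theta>) * circ \<theta>" for \<theta>
  define h where "h \<theta> = Re (g \<theta>)" for \<theta>
  have cont: "continuous_on A g" for A
    unfolding g_def by (intro continuous_intros f)
  have int: "g integrable_on {p..q}" for p q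
    by (intro integrable_continuous_real cont)
  have hint: "h integrable_on {p..q}" for p q
    unfolding h_def by (intro integrable_continuous_real continuous_intros cont)
  have "g (2 * pi - \<theta>) = cnj (g \<theta>)" for \<theta>
    by (simp add: g_def circ_reflect genfun_cnj[OF circ_slit] sym)
  then have "h (2 * pi - \<theta>) = h \<theta>" for \<theta>
    by (simp add: h_def)
  then have refl: "h (- \<theta>) = h (2 * pi + \<theta>)" for \<theta>
    by (metis diff_minus_eq_add)
  have "integral {pi..2*pi} h = integral {- pi + 2 * pi..-0 + 2 * pi} h" by simp
  also have "\<dots> = integral {-pi..-0} (\<lambda>\<theta>. h (- \<theta>))"
    unfolding integral_shift_Icc_real[symmetric] by (simp add: o_def refl)
  also have "\<dots> = integral {0..pi} h"
    by (rule Henstock_Kurzweil_Integration.integral_reflect_real)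
  finally have half: "integral {pi..2*pi} h = integral {0..pi} h" .
  have "integral {0..2*pi} h = integral {0..pi} h + integral {pi..2*pi} h"
    by (rule Henstock_Kurzweil_Integration.integral_combine[symmetric]) (use hint in auto)
  then have "integral {0..2*pi} h = 2 * integral {0..pi} h" using half by simp
  moreover have Re_int: "integral {p..q} h = Re (integral {p..q} g)" for p q
    unfolding h_def using integral_linear[OF int bounded_linear_Re] by (simp add: o_def)
  moreover have "residue_functional a c f = of_real (1 / (2 * pi)) * integral {0..2*pi} g"
    unfolding residue_functional_def g_def[abs_def] by simp
  moreover have "contour_integral (part_circlepath 0 2 0 pi) (\<lambda>y. genfun a c y * f y)
     = integral {0..pi} (\<lambda>t. \<i> * g t)"
    by (subst contour_integral_part_circlepath_eq) (simp_all add: g_def circ_def mult_ac)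
  ultimately show ?thesis by simp
qed

lemma mult_abs_ln_le:
  fixes r :: real
  assumes "r > 0"
  shows "r * \<bar>ln r\<bar> \<le> 1 + r\<^sup>2"
proof (cases "r \<ge> 1")
  case True
  then have "0 \<le> ln r" "ln r < r" using ln_less_self[of r] by simp_all
  then have "r * \<bar>ln r\<bar> \<le> r * r"
    by (intro mult_left_mono) linarith+
  then show ?thesis by (simp add: power2_eq_square)
next
  case False
  have "\<bar>ln r\<bar> = ln (1 / r)" using False assms by (simp add: ln_div)
  also have "\<dots> \<le> 1 / r" using ln_less_self[of "1 / r"] assms by (simp add: less_imp_le)
  finally have "r * \<bar>ln r\<bar> \<le> r * (1 / r)" using assms by (intro mult_left_mono) auto
  then show ?thesis using assms by (simp add: add_increasing2)
qed

text \<open>Uniformity up to the real axis is the point. In the exponent, \<open>a y + c\<close> is replaced by its value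
\<open>c\<close> at \<open>y = 0\<close> for the factor \<open>ln |y|\<close>, where \<open>c \<ge> 0\<close> gives an upper bound, and by its value
\<open>a + c\<close> at \<open>y = 1\<close> for the factor \<open>ln |y - 1|\<close>; the errors are of the form \<open>r |ln r|\<close>, hence bounded. The branch of
the logarithm contributes at most \<open>a \<pi> Im y\<close>.\<close>
lemma norm_genfun_le:
  assumes a: "a \<ge> 0" and c: "c \<ge> 0"
    and y: "\<bar>Re y\<bar> \<le> 2" "0 < Im y" "Im y \<le> 1"
  shows "norm (genfun a c y) \<le> exp (26 * a + 2 * c + a * pi) * norm (y - 1) powr - (a + c)"
proof -
  define r where "r = norm y"
  define r' where "r' = norm (y - 1)"
  define w where "w = 1 - 1 / y"
  have nz: "y \<noteq> 0" "y - 1 \<noteq> 0" using y by (auto simp: complex_eq_iff)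
  then have pos: "r > 0" "r' > 0" by (auto simp: r_def r'_def)
  have r3: "r \<le> 3"
    using cmod_le[of y] y unfolding r_def by linarith
  have r4: "r' \<le> 4"
    using norm_triangle_ineq4[of y 1] r3 unfolding r_def r'_def by simp
  have xr: "\<bar>Re y\<bar> \<le> r" "\<bar>Re y - 1\<bar> \<le> r'"
    using abs_Re_le_cmod[of y] abs_Re_le_cmod[of "y - 1"] by (simp_all add: r_def r'_def)
  have w: "w \<noteq> 0" "norm w = r' / r"
  proof -
    have "w = (y - 1) / y" using nz by (simp add: w_def diff_divide_distrib)
    then show "w \<noteq> 0" "norm w = r' / r" using nz by (simp_all add: r_def r'_def norm_divide)
  qed
  have T1: "a * (Re y * ln r) \<le> a * 10"
  proof (rule mult_left_mono[OF _ a])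
    have "Re y * ln r \<le> \<bar>Re y\<bar> * \<bar>ln r\<bar>" by (metis abs_ge_self abs_mult)
    also have "\<dots> \<le> r * \<bar>ln r\<bar>" using xr by (intro mult_right_mono) auto
    also have "\<dots> \<le> 1 + r\<^sup>2" by (rule mult_abs_ln_le[OF pos(1)])
    also have "\<dots> \<le> 1 + 3\<^sup>2" using r3 pos by (intro add_left_mono power_mono) auto
    finally show "Re y * ln r \<le> 10" by simp
  qed
  have T2: "a * (- ((Re y - 1) * ln r')) \<le> a * 17"
  proof (rule mult_left_mono[OF _ a])
    have "- ((Re y - 1) * ln r') \<le> \<bar>Re y - 1\<bar> * \<bar>ln r'\<bar>" by (metis abs_ge_minus_self abs_mult)
    also have "\<dots> \<le> r' * \<bar>ln r'\<bar>" using xr by (intro mult_right_mono) auto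
    also have "\<dots> \<le> 1 + r'\<^sup>2" by (rule mult_abs_ln_le[OF pos(2)])
    also have "\<dots> \<le> 1 + 4\<^sup>2" using r4 pos by (intro add_left_mono power_mono) auto
    finally show "- ((Re y - 1) * ln r') \<le> 17" by simp
  qed
  have "ln r \<le> 2" using ln_le_minus_one[OF pos(1)] r3 by linarith
  then have T3: "c * ln r \<le> c * 2" using c by (intro mult_left_mono) auto
  have T4: "a * (Im y * Im (Ln w)) \<le> a * pi"
  proof (rule mult_left_mono[OF _ a])
    have "\<bar>Im (Ln w)\<bar> \<le> pi" using w mpi_less_Im_Ln[of w] Im_Ln_le_pi[of w] by linarith
    then have "\<bar>Im y\<bar> * \<bar>Im (Ln w)\<bar> \<le> 1 * pi" using y by (intro mult_mono) auto
    moreover have "Im y * Im (Ln w) \<le> \<bar>Im y\<bar> * \<bar>Im (Ln w)\<bar>" by (metis abs_ge_self abs_mult)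
    ultimately show "Im y * Im (Ln w) \<le> pi" by linarith
  qed
  have "Re (- of_real a - (of_real a * y + of_real c) * Ln w) =
      - a - (a * Re y + c) * ln (norm w) + a * (Im y * Im (Ln w))"
    using w by (simp add: Re_Ln algebra_simps)
  also have "\<dots> = - a + a * (Re y * ln r) + c * ln r + a * (- ((Re y - 1) * ln r'))
      + a * (Im y * Im (Ln w)) - (a + c) * ln r'"
    using pos unfolding w by (simp add: ln_div algebra_simps)
  also have "\<dots> \<le> (26 * a + 2 * c + a * pi) - (a + c) * ln r'"
    using T1 T2 T3 T4 by linarith
  finally have "norm (genfun a c y) \<le> exp ((26 * a + 2 * c + a * pi) - (a + c) * ln r')"
    by (simp add: genfun_def w_def)
  also have "\<dots> = exp (26 * a + 2 * c + a * pi) * r' powr - (a + c)"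
    using pos by (simp add: powr_def exp_diff exp_minus divide_inverse algebra_simps exp_add)
  finally show ?thesis by (simp add: r'_def)
qed

text \<open>The bracket in the definition of \<^const>\<open>D\<close>, as an entire function.\<close>
definition exp_tail :: "real \<Rightarrow> complex \<Rightarrow> complex" where
  "exp_tail t y = exp ((1 - y) * of_real t) - 1 - (1 - y) * of_real t"

lemma norm_exp_tail_le:
  assumes "\<bar>Re y\<bar> \<le> 2"
  shows "norm (exp_tail t y) \<le> exp (3 * \<bar>t\<bar>) * t\<^sup>2 * (norm (y - 1))\<^sup>2"
proof -
  have "norm (exp_tail t y) \<le> exp \<bar>Re ((1 - y) * of_real t)\<bar> * norm ((1 - y) * of_real t) ^ 2"
    using Taylor_exp[of "(1 - y) * of_real t" 1] by (simp add: exp_tail_def power2_eq_square algebra_simps)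
  also have "\<dots> \<le> exp (3 * \<bar>t\<bar>) * norm ((1 - y) * of_real t) ^ 2"
    using assms by (intro mult_right_mono) (auto simp: abs_mult intro!: mult_right_mono)
  also have "\<dots> = exp (3 * \<bar>t\<bar>) * t\<^sup>2 * (norm (y - 1))\<^sup>2"
    by (simp add: norm_mult power_mult_distrib norm_minus_commute)
  finally show ?thesis .
qed

lemma exp_tail_holomorphic: "exp_tail t holomorphic_on A"
  unfolding exp_tail_def by (intro holomorphic_intros)

lemma continuous_exp_tail: "continuous_on A (exp_tail t)"
  by (intro holomorphic_on_imp_continuous_on exp_tail_holomorphic)

lemma exp_tail_cnj: "exp_tail t (cnj y) = cnj (exp_tail t y)"
  by (simp add: exp_tail_def exp_cnj)

lemma genfun_holomorphic_off_slit:
  assumes "\<And>y. y \<in> A \<Longrightarrow> y \<notin> of_real ` {0..1}"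
  shows "genfun a c holomorphic_on A"
proof -
  have "0 \<notin> A" using assms[of 0] by force
  then show ?thesis
    unfolding genfun_def[abs_def]
    by (intro holomorphic_intros) (use one_minus_inverse_slit assms in auto)
qed

lemma integrable_powr_dominant:
  assumes "p > -1"
  shows "integrable lborel (\<lambda>x::real. indicator {0..3} x *\<^sub>R x powr p)"
proof -
  have "(\<lambda>x. x powr p) integrable_on {0..3}"
    by (rule integrable_on_powr_from_0) (use assms in auto)
  then have "(\<lambda>x. x powr p) absolutely_integrable_on {0..3}"
    by (subst absolutely_integrable_on_iff_nonneg) auto
  then show ?thesis
    unfolding set_integrable_def by (subst (asm) integrable_completion) simp_all
qed

text \<open>The double zero of \<^const>\<open>exp_tail\<close> at \<open>1\<close> turns the order \<open>- (a + c)\<close> of \<^const>\<open>genfun\<close> into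
\<open>2 - (a + c)\<close>. On \<^const>\<open>Omega\<close> this exceeds \<open>-1\<close>, so the bound is locally integrable on the real line. The constant \<open>16 = 4\<^sup>2\<close> covers the case of
a nonnegative exponent, as \<open>|y - 1| \<le> 4\<close>.\<close>
lemma norm_genfun_exp_tail_le:
  assumes a: "a > 0" and c: "c \<ge> 0"
  shows "\<exists>K\<ge>0. \<forall>y. \<bar>Re y\<bar> \<le> 2 \<longrightarrow> 0 < Im y \<longrightarrow> Im y \<le> 1 \<longrightarrow> Re y \<noteq> 1 \<longrightarrow>
     norm (genfun a c y * exp_tail t y) \<le> K * (16 + \<bar>Re y - 1\<bar> powr (2 - (a + c)))"
proof (intro exI conjI allI impI)
  let ?K = "exp (26 * a + 2 * c + a * pi) * (exp (3 * \<bar>t\<bar>) * t\<^sup>2)"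
  show "?K \<ge> 0" by simp
  fix y :: complex
  assume y: "\<bar>Re y\<bar> \<le> 2" "0 < Im y" "Im y \<le> 1" "Re y \<noteq> 1"
  define r where "r = norm (y - 1)"
  have r: "r > 0" "\<bar>Re y - 1\<bar> \<le> r"
    using y abs_Re_le_cmod[of "y - 1"] by (auto simp: r_def)
  have r4: "r \<le> 4"
    using cmod_le[of "y - 1"] y unfolding r_def by simp
  have "norm (genfun a c y * exp_tail t y) \<le>
     (exp (26 * a + 2 * c + a * pi) * r powr - (a + c)) * (exp (3 * \<bar>t\<bar>) * t\<^sup>2 * r\<^sup>2)"
    unfolding norm_mult r_def using a c y
    by (intro mult_mono norm_genfun_le norm_exp_tail_le) auto
  also have "\<dots> = ?K * (r powr - (a + c) * r powr 2)"
    using r by (simp add: powr_numeral)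
  also have "r powr - (a + c) * r powr 2 = r powr (2 - (a + c))"
    by (metis powr_add uminus_add_conv_diff)
  also have "\<dots> \<le> 16 + \<bar>Re y - 1\<bar> powr (2 - (a + c))"
  proof (cases "2 - (a + c) \<ge> 0")
    case True
    have "r powr (2 - (a + c)) \<le> 4 powr (2 - (a + c))"
      using True r r4 by (intro powr_mono2) auto
    also have "\<dots> \<le> 4 powr 2" using a c by (intro powr_mono) auto
    finally show ?thesis by (simp add: powr_numeral add_increasing2)
  next
    case False
    then have "r powr (2 - (a + c)) \<le> \<bar>Re y - 1\<bar> powr (2 - (a + c))"
      using r y by (intro powr_mono2') auto
    then show ?thesis by simp
  qed
  finally show "norm (genfun a c y * exp_tail t y) \<le> ?K * (16 + \<bar>Re y - 1\<bar> powr (2 - (a + c)))"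
    by (simp add: mult_left_mono)
qed

definition offset :: "nat \<Rightarrow> real" where "offset n = 1 / real (Suc n)"

lemma offset_bounds: "0 < offset n" "offset n \<le> 1"
  by (auto simp: offset_def)

lemma offset_tendsto: "offset \<longlonglongrightarrow> 0"
  unfolding offset_def using LIMSEQ_inverse_real_of_nat by (simp add: inverse_eq_divide)

text \<open>The limit of \<open>Ln (1 - 1/y)\<close> as \<open>y\<close> tends to \<open>x\<close> from the upper half plane: on the slit \<open>1 - 1/y\<close>
approaches the negative axis from above.\<close>
definition Ln_boundary :: "real \<Rightarrow> complex" where
  "Ln_boundary x = (if 0 < x \<and> x < 1 then of_real (ln ((1 - x) / x)) + \<i> * pi else of_real (ln (1 - 1 / x)))"

lemma Ln_tendsto_boundary:
  assumes "x \<noteq> 0" "x \<noteq> 1"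
  shows "(\<lambda>n. Ln (1 - 1 / (of_real x + \<i> * of_real (offset n)))) \<longlonglongrightarrow> Ln_boundary x"
proof -
  define W where "W n = 1 - 1 / (of_real x + \<i> * of_real (offset n))" for n
  have s0: "(\<lambda>n. of_real x + \<i> * of_real (offset n)) \<longlonglongrightarrow> of_real x + \<i> * of_real 0"
    by (intro tendsto_intros offset_tendsto)
  have W: "W \<longlonglongrightarrow> 1 - 1 / (of_real x + \<i> * of_real 0)"
    unfolding W_def using assms by (intro tendsto_intros s0) auto
  show ?thesis
  proof (cases "0 < x \<and> x < 1")
    case True
    have imW: "Im (W n) > 0" for n
    proof -
      have "Im (W n) = offset n / (x\<^sup>2 + (offset n)\<^sup>2)"
        by (simp add: W_def Im_divide)
      then show ?thesis using offset_bounds(1)[of n] by (simp add: add_nonneg_pos)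
    qed
    have "(\<lambda>n. - W n) \<longlonglongrightarrow> of_real ((1 - x) / x)"
      using tendsto_minus[OF W] True by (simp add: diff_divide_distrib)
    moreover have pos: "(1 - x) / x > 0" using True by simp
    have "complex_of_real ((1 - x) / x) \<notin> \<real>\<^sub>\<le>\<^sub>0"
      using pos by (auto simp only: complex_nonpos_Reals_iff Re_complex_of_real)
    ultimately have "(\<lambda>n. Ln (- W n) + \<i> * pi) \<longlonglongrightarrow> Ln (of_real ((1 - x) / x)) + \<i> * pi"
      by (intro tendsto_intros)
    moreover have "Ln (- W n) + \<i> * pi = Ln (W n)" for n
    proof -
      have "W n \<noteq> 0" using imW[of n] by auto
      then show ?thesis using imW[of n] by (subst Ln_minus) auto
    qed
    moreover have "Ln (of_real ((1 - x) / x)) = of_real (ln ((1 - x) / x))"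
      using pos by (intro Ln_of_real)
    ultimately show ?thesis using True by (simp add: Ln_boundary_def W_def)
  next
    case False
    then have pos: "1 - 1 / x > 0" using assms by (auto simp: field_simps)
    have "W \<longlonglongrightarrow> of_real (1 - 1 / x)" using W by simp
    moreover have "complex_of_real (1 - 1 / x) \<notin> \<real>\<^sub>\<le>\<^sub>0"
      using pos by (auto simp only: complex_nonpos_Reals_iff Re_complex_of_real)
    ultimately have "(\<lambda>n. Ln (W n)) \<longlonglongrightarrow> Ln (of_real (1 - 1 / x))"
      by (intro tendsto_intros)
    moreover have "Ln (of_real (1 - 1 / x)) = of_real (ln (1 - 1 / x))"
      using pos by (intro Ln_of_real)
    moreover have "Ln_boundary x = of_real (ln (1 - 1 / x))"
      using False by (auto simp: Ln_boundary_def)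
    ultimately show ?thesis by (simp add: W_def)
  qed
qed

definition boundary_value :: "real \<Rightarrow> real \<Rightarrow> real \<Rightarrow> complex" where
  "boundary_value a c x = exp (- of_real a - (of_real a * of_real x + of_real c) * Ln_boundary x)"

text \<open>Off the slit the boundary values are real, and on it their imaginary part is
\<open>- \<pi> e\<^sup>-\<^sup>a\<close> times the weight.\<close>
lemma Im_boundary_value:
  "Im (boundary_value a c x) = - (indicator {0<..<1} x * (pi * exp (- a) * w a c x))"
proof (cases "0 < x \<and> x < 1")
  case True
  define l where "l = ln ((1 - x) / x)"
  have l: "l = - ln (x / (1 - x))" using True by (simp add: l_def ln_div)
  have "- of_real a - (of_real a * of_real x + of_real c) * Ln_boundary x =
      Complex (- a - (a * x + c) * l) (- (pi * (a * x + c)))"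
    unfolding Ln_boundary_def l_def[symmetric] using True
    by (simp add: complex_eq_iff algebra_simps)
  then have "boundary_value a c x = exp (Complex (- a - (a * x + c) * l) (- (pi * (a * x + c))))"
    unfolding boundary_value_def by (simp only:)
  then have "Im (boundary_value a c x) = - (exp (- a - (a * x + c) * l) * sin (pi * (a * x + c)))"
    by (simp add: Im_exp)
  also have "exp (- a - (a * x + c) * l) = exp (- a) * (x / (1 - x)) powr (a * x + c)"
    using True by (simp add: l powr_def flip: exp_add)
  finally show ?thesis using True by (simp add: w_def)
next
  case False
  then have "Ln_boundary x = of_real (ln (1 - 1 / x))"
    by (auto simp: Ln_boundary_def)
  then have "boundary_value a c x = of_real (exp (- a - (a * x + c) * ln (1 - 1 / x)))"
    unfolding boundary_value_def by (simp flip: exp_of_real)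
  then show ?thesis using False by auto
qed

text \<open>Cauchy's theorem for the upper half disc of radius \<open>2\<close>, applied to the integrand moved down by a
small \<open>\<epsilon>\<close>, which puts all singularities below the contour. As \<open>\<epsilon> \<rightarrow> 0\<close> the arc converges by
continuity and the diameter \<open>[-2, 2]\<close> by dominated convergence to the integral of the boundary values.\<close>
lemma upper_arc_eq_slit_integral:
  assumes "(a, c) \<in> Omega"
  shows "Im (contour_integral (part_circlepath 0 2 0 pi) (\<lambda>y. genfun a c y * exp_tail t y)) =
     pi * exp (- a) * (LBINT s:{0<..<1}. w a c s * (exp ((1 - s) * t) - 1 - (1 - s) * t))"
proof -
  have a: "a > 0" and c: "c \<ge> 0" and ac: "a + c < 3" using assms by (auto simp: Omega_def)
  define F where "F y = genfun a c y * exp_tail t y" for y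
  define G where "G n y = F (y + \<i> * of_real (offset n))" for n y
  let ?arc = "part_circlepath 0 2 0 pi"
  define Hp where "Hp n = {y. Im y > - offset n}" for n

  have F_hol: "F holomorphic_on A" if "\<And>y. y \<in> A \<Longrightarrow> y \<notin> of_real ` {0..1}" for A
    unfolding F_def by (intro holomorphic_intros genfun_holomorphic_off_slit exp_tail_holomorphic that)
  have G_hol: "G n holomorphic_on Hp n" for n
  proof -
    have "F \<circ> (\<lambda>y. y + \<i> * of_real (offset n)) holomorphic_on Hp n"
    proof (rule holomorphic_on_compose)
      show "F holomorphic_on (\<lambda>y. y + \<i> * of_real (offset n)) ` Hp n"
        by (rule F_hol) (auto simp: Hp_def complex_eq_iff)
    qed (intro holomorphic_intros)
    then show ?thesis by (simp add: G_def[abs_def] o_def)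
  qed
  have Hp: "open (Hp n)" "convex (Hp n)" for n
    unfolding Hp_def by (auto intro: open_halfspace_Im_gt convex_halfspace_Im_gt)
  have arc_img: "path_image ?arc \<subseteq> Hp n" for n
  proof
    fix y assume "y \<in> path_image ?arc"
    then obtain \<theta> where \<theta>: "\<theta> \<in> {0..pi}" and y: "y = 2 * cis \<theta>"
      by (auto simp: path_image_part_circlepath' closed_segment_eq_real_ivl)
    have "sin \<theta> \<ge> 0" using \<theta> by (intro sin_ge_zero) auto
    then have "Im y \<ge> 0" by (simp add: y)
    then show "y \<in> Hp n" using offset_bounds(1)[of n] unfolding Hp_def by simp
  qed
  have lin_img: "path_image (linepath (-2) 2) \<subseteq> Hp n" for n
    unfolding path_image_linepath
    by (rule closed_segment_subset[OF _ _ Hp(2)]) (use offset_bounds(1)[of n] in \<open>auto simp: Hp_def\<close>)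
  have Cauchy: "contour_integral ?arc (G n) + contour_integral (linepath (-2) 2) (G n) = 0" for n
  proof -
    have fin: "pathfinish ?arc = -2" "pathstart ?arc = 2"
      by (simp_all add: exp_pi_i')
    have "(G n has_contour_integral 0) (?arc +++ linepath (-2) 2)"
      using arc_img[of n] lin_img[of n] fin
      by (intro Cauchy_theorem_convex_simple[OF G_hol Hp(2)]) (auto simp: path_image_join)
    then have "contour_integral (?arc +++ linepath (-2) 2) (G n) = 0"
      by (rule contour_integral_unique)
    moreover have "G n contour_integrable_on ?arc" "G n contour_integrable_on linepath (-2) 2"
      using contour_integrable_holomorphic_simple[OF G_hol Hp(1)] arc_img lin_img by auto
    ultimately show ?thesis by simp
  qed

  have arc_lim: "(\<lambda>n. contour_integral ?arc (G n)) \<longlonglongrightarrow> contour_integral ?arc F"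
  proof -
    let ?I = "\<lambda>e. integral (cbox 0 pi) (\<lambda>x. F (2 * cis x + \<i> * of_real e) * 2 * \<i> * cis x)"
    have off: "2 * cis x + \<i> * of_real e \<notin> of_real ` {0..1}" if "e \<in> {0..1}" "x \<in> {0..pi}" for e x
    proof (rule norm_gt_1_off_slit)
      have "sin x \<ge> 0" using that by (intro sin_ge_zero) auto
      then have "0 \<le> e * (4 * sin x) + e\<^sup>2" using that by simp
      moreover have "(norm (2 * cis x + \<i> * of_real e))\<^sup>2 =
          4 * (cos x)\<^sup>2 + 4 * (sin x)\<^sup>2 + (e * (4 * sin x) + e\<^sup>2)"
        unfolding cmod_power2 by (simp add: power2_eq_square algebra_simps)
      moreover have "4 * (cos x)\<^sup>2 + 4 * (sin x)\<^sup>2 = 2\<^sup>2"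
        by (simp flip: distrib_left)
      ultimately have "2\<^sup>2 \<le> (norm (2 * cis x + \<i> * of_real e))\<^sup>2" by linarith
      then have "2 \<le> norm (2 * cis x + \<i> * of_real e)"
        by (rule power2_le_imp_le) simp
      then show "1 < norm (2 * cis x + \<i> * of_real e)" by simp
    qed
    let ?P = "(\<lambda>p. 2 * cis (snd p) + \<i> * of_real (fst p)) ` ({0..1} \<times> {0..pi})"
    have "y \<notin> of_real ` {0..1}" if "y \<in> ?P" for y
      using that off by (metis (no_types, lifting) SigmaE imageE prod.sel)
    then have "continuous_on ?P F"
      by (intro holomorphic_on_imp_continuous_on F_hol)
    then have "continuous_on ({0..1} \<times> {0..pi}) (\<lambda>p. F (2 * cis (snd p) + \<i> * of_real (fst p)))"
      by (rule continuous_on_compose2) (auto intro!: continuous_intros)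
    then have "continuous_on ({0..1} \<times> {0..pi}) (\<lambda>p. F (2 * cis (snd p) + \<i> * of_real (fst p)) * 2 * \<i> * cis (snd p))"
      by (intro continuous_intros)
    then have "continuous_on {0..1} ?I"
      by (intro integral_continuous_on_param) (simp add: case_prod_unfold)
    then have "(\<lambda>n. ?I (offset n)) \<longlonglongrightarrow> ?I 0"
      using offset_bounds by (intro continuous_on_tendsto_compose[OF _ offset_tendsto])
        (auto intro!: always_eventually less_imp_le)
    moreover have "contour_integral ?arc (G n) = ?I (offset n)" for n
      by (subst contour_integral_part_circlepath_eq) (simp_all add: G_def)
    moreover have "contour_integral ?arc F = ?I 0"
      by (subst contour_integral_part_circlepath_eq) simp_all
    ultimately show ?thesis by simp
  qed

  define S where "S n x = indicator {-2..2} x *\<^sub>R G n (of_real x)" for n and x :: real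
  define L where "L x = indicator {-2..2} x *\<^sub>R (boundary_value a c x * exp_tail t (of_real x))" for x :: real
  have G_cont: "continuous_on A (\<lambda>x::real. G n (of_real x))" for A n
  proof (rule continuous_on_compose2[OF holomorphic_on_imp_continuous_on[OF G_hol[of n]]])
    show "of_real ` A \<subseteq> Hp n" using offset_bounds(1)[of n] by (auto simp: Hp_def)
  qed (intro continuous_intros)
  have line: "contour_integral (linepath (-2) 2) (G n) = integral\<^sup>L lborel (S n)" for n
  proof -
    have "set_integrable lborel {-2..2} (\<lambda>x::real. G n (of_real x))"
      unfolding set_integrable_def
      by (rule borel_integrable_compact) (auto intro: G_cont)
    from set_borel_integral_eq_integral(2)[OF this]
    have "integral\<^sup>L lborel (S n) = integral {-2..2} (\<lambda>x. G n (of_real x))"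
      by (simp add: set_lebesgue_integral_def S_def[abs_def])
    then show ?thesis by (subst contour_integral_linepath_Reals_eq) simp_all
  qed
  obtain K where K: "K \<ge> 0" and bound: "\<And>y. \<lbrakk>\<bar>Re y\<bar> \<le> 2; 0 < Im y; Im y \<le> 1; Re y \<noteq> 1\<rbrakk> \<Longrightarrow>
     norm (F y) \<le> K * (16 + \<bar>Re y - 1\<bar> powr (2 - (a + c)))"
    using norm_genfun_exp_tail_le[OF a c, of t] unfolding F_def by blast
  define \<phi> where "\<phi> x = indicator {0..3} x *\<^sub>R x powr (2 - (a + c))" for x :: real
  have \<phi>: "integrable lborel \<phi>"
    unfolding \<phi>_def[abs_def] by (rule integrable_powr_dominant) (use ac in simp)
  \<comment> \<open>The two copies of \<open>\<phi>\<close> dominate the singularity of \<open>|x - 1|\<close> to the right and to the left of \<open>1\<close>.\<close>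
  define B where "B x = K * (16 * indicator {-2..2} x + (\<phi> (- 1 + 1 * x) + \<phi> (1 + (- 1) * x)))" for x :: real
  have B: "integrable lborel B"
    unfolding B_def[abs_def]
    by (intro integrable_mult_right Bochner_Integration.integrable_add
        lborel_integrable_real_affine[OF \<phi>] integrable_real_indicator) auto
  have S_meas: "S n \<in> borel_measurable lborel" for n
  proof -
    have "S n \<in> borel_measurable borel"
      unfolding S_def[abs_def] by (intro borel_measurable_continuous_on_indicator G_cont) auto
    then show ?thesis by simp
  qed
  have L_meas: "L \<in> borel_measurable lborel"
  proof -
    have [measurable]: "(\<lambda>x::real. exp_tail t (of_real x)) \<in> borel_measurable borel"
      unfolding exp_tail_def by (intro borel_measurable_continuous_onI continuous_intros)
    have [measurable]: "Ln_boundary \<in> borel_measurable borel"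
      unfolding Ln_boundary_def[abs_def] by measurable
    have [measurable]: "boundary_value a c \<in> borel_measurable borel"
      unfolding boundary_value_def[abs_def] by measurable
    show ?thesis unfolding L_def[abs_def] by measurable
  qed
  have ne: "AE x in lborel. x \<noteq> (0::real) \<and> x \<noteq> 1"
    using AE_lborel_singleton[of "0::real"] AE_lborel_singleton[of "1::real"] by eventually_elim simp
  have lim: "AE x in lborel. (\<lambda>n. S n x) \<longlonglongrightarrow> L x"
    using ne
  proof eventually_elim
    case (elim x)
    have "(\<lambda>n. of_real x + \<i> * of_real (offset n)) \<longlonglongrightarrow> of_real x + \<i> * of_real 0"
      by (intro tendsto_intros offset_tendsto)
    then have s0: "(\<lambda>n. of_real x + \<i> * of_real (offset n)) \<longlonglongrightarrow> of_real x" by simp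
    have "(\<lambda>n. genfun a c (of_real x + \<i> * of_real (offset n))) \<longlonglongrightarrow> boundary_value a c x"
      unfolding genfun_def boundary_value_def using elim
      by (intro tendsto_intros s0 Ln_tendsto_boundary) auto
    moreover have "(\<lambda>n. exp_tail t (of_real x + \<i> * of_real (offset n))) \<longlonglongrightarrow> exp_tail t (of_real x)"
      by (rule continuous_on_tendsto_compose[OF continuous_exp_tail[of UNIV] s0]) auto
    ultimately show ?case
      unfolding S_def G_def F_def L_def by (intro tendsto_intros)
  qed
  have dom: "AE x in lborel. norm (S n x) \<le> B x" for n
    using ne
  proof eventually_elim
    case (elim x)
    have nn: "\<phi> u \<ge> 0" for u by (simp add: \<phi>_def)
    show ?case
    proof (cases "x \<in> {-2..2}")
      case True
      then have "\<bar>x\<bar> \<le> 2" by auto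
      then have "norm (S n x) \<le> K * (16 + \<bar>x - 1\<bar> powr (2 - (a + c)))"
        using True bound[of "of_real x + \<i> * of_real (offset n)"] elim offset_bounds[of n]
        by (simp add: S_def G_def)
      moreover have "\<bar>x - 1\<bar> powr (2 - (a + c)) \<le> \<phi> (- 1 + 1 * x) + \<phi> (1 + (- 1) * x)"
      proof (cases "x \<ge> 1")
        case True
        then have "\<bar>x - 1\<bar> powr (2 - (a + c)) = \<phi> (- 1 + 1 * x)"
          using \<open>x \<in> {-2..2}\<close> by (simp add: \<phi>_def)
        then show ?thesis using nn by simp
      next
        case False
        then have "\<bar>x - 1\<bar> powr (2 - (a + c)) = \<phi> (1 + (- 1) * x)"
          using \<open>x \<in> {-2..2}\<close> by (simp add: \<phi>_def)
        then show ?thesis using nn by simp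
      qed
      then have "K * (16 + \<bar>x - 1\<bar> powr (2 - (a + c))) \<le> K * (16 + (\<phi> (- 1 + 1 * x) + \<phi> (1 + (- 1) * x)))"
        using K by (intro mult_left_mono add_left_mono)
      ultimately show ?thesis using True by (simp add: B_def)
    next
      case False
      then show ?thesis using K nn by (simp add: S_def B_def)
    qed
  qed
  note dc = L_meas S_meas B lim dom
  have L_int: "integrable lborel L"
    by (rule integrable_dominated_convergence[OF dc])
  have "(\<lambda>n. integral\<^sup>L lborel (S n)) \<longlonglongrightarrow> integral\<^sup>L lborel L"
    by (rule integral_dominated_convergence[OF dc])
  then have "(\<lambda>n. contour_integral ?arc (G n) + contour_integral (linepath (-2) 2) (G n))
      \<longlonglongrightarrow> contour_integral ?arc F + integral\<^sup>L lborel L"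
    unfolding line by (intro tendsto_add arc_lim)
  then have "contour_integral ?arc F + integral\<^sup>L lborel L = 0"
    unfolding Cauchy using LIMSEQ_unique tendsto_const by blast
  then have "Im (contour_integral ?arc F) = - Im (integral\<^sup>L lborel L)"
    by (simp add: add_eq_0_iff)
  also have "Im (integral\<^sup>L lborel L) = integral\<^sup>L lborel (\<lambda>x. Im (L x))"
    by (rule integral_Im[OF L_int, symmetric])
  also have "(\<lambda>x. Im (L x)) = (\<lambda>x. - (pi * exp (- a)) *
       (indicator {0<..<1} x *\<^sub>R (w a c x * (exp ((1 - x) * t) - 1 - (1 - x) * t))))"
  proof
    fix x :: real
    have r: "exp_tail t (of_real x) = of_real (exp ((1 - x) * t) - 1 - (1 - x) * t)"
      by (simp add: exp_tail_def flip: exp_of_real)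
    have "Im (L x) = indicator {-2..2} x * (Im (boundary_value a c x) * (exp ((1 - x) * t) - 1 - (1 - x) * t))"
      unfolding L_def r by simp
    then show "Im (L x) = - (pi * exp (- a)) *
       (indicator {0<..<1} x *\<^sub>R (w a c x * (exp ((1 - x) * t) - 1 - (1 - x) * t)))"
      unfolding Im_boundary_value by (auto simp: indicator_def)
  qed
  finally show ?thesis unfolding F_def[abs_def] set_lebesgue_integral_def by simp
qed

text \<open>The terms \<open>q1\<close> and \<open>q2\<close> in the definition of \<^const>\<open>D\<close> are exactly the values of the residue
functional on the linear polynomial which \<^const>\<open>exp_tail\<close> subtracts from the exponential.\<close>
lemma m_eq_Re_laplace_w:
  assumes "(a, c) \<in> Omega"
  shows "m a c t = Re (laplace_w a c t)"
proof -
  define I where "I = (LBINT s:{0<..<1}. w a c s * (exp ((1 - s) * t) - 1 - (1 - s) * t))"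
  have "Re (residue_functional a c (exp_tail t)) = exp (- a) * I"
    unfolding I_def using Re_residue_functional_eq_upper_arc[OF continuous_exp_tail exp_tail_cnj] upper_arc_eq_slit_integral[OF assms]
    by simp
  moreover have "residue_functional a c (exp_tail t) =
     of_real (exp t) * laplace_w a c t - of_real (1 + t) * of_real (q1 a c) + of_real t * of_real (q2 a c)"
  proof -
    have "exp ((1 - y) * of_real t) = of_real (exp t) * exp (- (of_real t * y))" for y :: complex
      by (simp add: algebra_simps exp_diff exp_minus divide_inverse flip: exp_of_real)
    then have "exp_tail t = (\<lambda>y. (of_real (exp t) * exp (- (of_real t * y)) - of_real (1 + t) * 1) + of_real t * y)"
      unfolding exp_tail_def by (simp add: fun_eq_iff algebra_simps)
    then have "residue_functional a c (exp_tail t) =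
       residue_functional a c (\<lambda>y. of_real (exp t) * exp (- (of_real t * y)) - of_real (1 + t) * 1)
       + residue_functional a c (\<lambda>y. of_real t * y)"
      by (simp only:) (intro residue_functional_add continuous_intros)
    also have "residue_functional a c (\<lambda>y. of_real (exp t) * exp (- (of_real t * y)) - of_real (1 + t) * 1) =
       residue_functional a c (\<lambda>y. of_real (exp t) * exp (- (of_real t * y))) - residue_functional a c (\<lambda>y. of_real (1 + t) * 1)"
      by (intro residue_functional_diff continuous_intros)
    finally show ?thesis
      unfolding residue_functional_cmult residue_functional_one residue_functional_id laplace_w_def .
  qed
  ultimately have "exp (- a) * I = exp t * Re (laplace_w a c t) - (1 + t) * q1 a c + t * q2 a c"
    by simp
  then have "D a c t = exp t * Re (laplace_w a c t)"
    unfolding D_def I_def[symmetric] by (simp add: algebra_simps)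
  then show ?thesis by (simp add: m_def exp_minus)
qed

section \<open>Signs at a zero\<close>

text \<open>As \<open>e\<^sup>s\<^sup>T R(s)\<close> decreases strictly, \<open>R\<close> changes sign at most once, from positive to negative. Should
\<open>R 1\<close> be nonnegative, all earlier values would exceed it, against the balance equation. With
\<open>R 1 < 0\<close>, either \<open>R\<close> is negative throughout or the balance equation makes \<open>\<integral>R\<close> negative. For a sign
change at \<open>\<sigma>\<close> the moment satisfies \<open>\<integral> s R \<le> \<sigma> \<integral> R\<close>, because \<open>(s - \<sigma>) R(s) \<le> 0\<close>.\<close>
lemma sign_of_moments:
  fixes R :: "real \<Rightarrow> real"
  assumes a: "a > 0" and c: "c \<ge> 0" and T: "T > 0"
    and cont: "continuous_on {0..1} R"
    and decr: "\<And>s s'. \<lbrakk>0 \<le> s; s < s'; s' \<le> 1\<rbrakk> \<Longrightarrow> exp (s' * T) * R s' < exp (s * T) * R s"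
    and balance: "a * integral {0..1} R + c * R 0 = (a + c) * R 1"
  shows "integral {0..1} R < 0" "integral {0..1} (\<lambda>s. s * R s) < 0"
proof -
  have neg: "R s' < 0" if "0 \<le> s" "s < s'" "s' \<le> 1" "R s \<le> 0" for s s'
  proof -
    have "exp (s' * T) * R s' < 0"
      using decr[OF that(1-3)] mult_nonneg_nonpos[of "exp (s * T)" "R s"] that(4) by simp
    then show ?thesis by (simp add: mult_less_0_iff)
  qed
  have pos: "R s > 0" if "0 \<le> s" "s < s'" "s' \<le> 1" "R s' \<ge> 0" for s s'
    using neg[OF that(1-3)] that(4) by linarith
  have R1: "R 1 < 0"
  proof (rule ccontr)
    assume "\<not> R 1 < 0"
    then have nn: "R 1 \<ge> 0" by simp
    have gt: "R 1 < R s" if "0 \<le> s" "s < 1" for s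
    proof -
      have "exp (s * T) * R 1 \<le> exp (1 * T) * R 1"
        using that T nn by (intro mult_right_mono) auto
      also have "\<dots> < exp (s * T) * R s" using that by (intro decr) auto
      finally show ?thesis by simp
    qed
    have "integral {0..1} (\<lambda>s::real. R 1) < integral {0..1} R"
      by (rule integral_less_real) (use cont gt in auto)
    then have "a * R 1 < a * integral {0..1} R" using a by simp
    moreover have "c * R 1 \<le> c * R 0" using c gt[of 0] by (intro mult_left_mono) auto
    ultimately show False using balance by (simp add: algebra_simps)
  qed
  have neg_all: "integral {0..1} (\<lambda>s. f s * R s) < 0"
    if "R 0 \<le> 0" "continuous_on {0..1} f" "\<And>s. 0 < s \<Longrightarrow> s < 1 \<Longrightarrow> f s > 0" for f
  proof -
    have "integral {0..1} (\<lambda>s. f s * R s) < integral {0..1} (\<lambda>s::real. 0)"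
      using that neg[of 0] by (intro integral_less_real continuous_intros cont) (auto simp: mult_pos_neg)
    then show ?thesis by simp
  qed
  show int_neg: "integral {0..1} R < 0"
  proof (cases "R 0 \<le> 0")
    case True
    then show ?thesis using neg_all[of "\<lambda>_. 1"] by simp
  next
    case False
    have "(a + c) * R 1 < 0" using a c R1 by (simp add: mult_pos_neg add_pos_nonneg)
    moreover have "c * R 0 \<ge> 0" using c False by simp
    ultimately have "a * integral {0..1} R < 0" using balance by linarith
    then show ?thesis using a by (simp add: mult_less_0_iff)
  qed
  show "integral {0..1} (\<lambda>s. s * R s) < 0"
  proof (cases "R 0 \<le> 0")
    case True
    then show ?thesis using neg_all[of "\<lambda>s. s"] by simp
  next
    case False
    then obtain \<sigma> where \<sigma>: "0 \<le> \<sigma>" "\<sigma> \<le> 1" "R \<sigma> = 0"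
      using IVT2'[of R 1 0 0] R1 cont by auto
    have "\<sigma> > 0" using \<sigma> False by (cases "\<sigma> = 0") auto
    have int: "(\<lambda>s. s * R s) integrable_on {0..1}" "(\<lambda>s. \<sigma> * R s) integrable_on {0..1}"
      by (intro integrable_continuous_real continuous_intros cont)+
    have "integral {0..1} (\<lambda>s. s * R s) \<le> integral {0..1} (\<lambda>s. \<sigma> * R s)"
    proof (rule integral_le[OF int])
      fix s :: real assume s: "s \<in> {0..1}"
      consider "s < \<sigma>" | "s = \<sigma>" | "s > \<sigma>" by linarith
      then show "s * R s \<le> \<sigma> * R s"
      proof cases
        case 1
        then show ?thesis using pos[of s \<sigma>] s \<sigma> by (intro mult_right_mono) auto
      next
        case 3
        then show ?thesis using neg[of \<sigma> s] s \<sigma> by (intro mult_right_mono_neg) auto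
      qed simp
    qed
    also have "\<dots> = \<sigma> * integral {0..1} R" by simp
    also have "\<dots> < 0" using \<open>\<sigma> > 0\<close> int_neg by (simp add: mult_pos_neg)
    finally show ?thesis .
  qed
qed

lemma continuous_resolvent:
  assumes "0 \<le> t"
  shows "continuous_on {0..1} (resolvent a c t)"
proof -
  have "continuous_on ({0..1} \<times> {0..t}) (\<lambda>p. exp (of_real (fst p * snd p)) * laplace_w a c (snd p))"
    by (intro continuous_intros continuous_on_compose2[OF continuous_laplace_w[of UNIV] continuous_on_snd]) auto
  then have "continuous_on {0..1} (\<lambda>s. integral (cbox 0 t) (\<lambda>u. exp (of_real (s * u)) * laplace_w a c u))"
    by (intro integral_continuous_on_param) (simp add: case_prod_unfold)
  then have "continuous_on {0..1} (\<lambda>s. exp (- of_real (s * t)) * (1 - integral {0..t} (\<lambda>u. exp (of_real (s * u)) * laplace_w a c u)))"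
    by (intro continuous_intros) simp
  then show ?thesis
    by (rule continuous_on_eq)
      (simp add: resolvent_Volterra[OF _ assms, symmetric] exp_minus del: of_real_mult)
qed

lemma Re_integral:
  fixes f :: "real \<Rightarrow> complex"
  assumes "continuous_on {p..q} f"
  shows "Re (integral {p..q} f) = integral {p..q} (\<lambda>x. Re (f x))"
  using integral_linear[OF integrable_continuous_real[OF assms] bounded_linear_Re] by (simp add: o_def)

theorem lemma14:
  fixes a c t0 :: real
  assumes "(a, c) \<in> Omega"
    and "\<And>t. t \<ge> 0 \<Longrightarrow> m a c t \<ge> 0"
    and "t0 > 0"
    and "m a c t0 = 0"
  shows "(\<exists>da. ((\<lambda>x. m x c t0) has_real_derivative da) (at a) \<and> da < 0) \<and>
         (\<exists>dc. ((\<lambda>y. m a y t0) has_real_derivative dc)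
                  (if c = 0 then at_right 0 else at c) \<and> dc < 0)"
proof -
  have a: "a > 0" and c: "c \<ge> 0" "c < 1" and ac: "a + c < 3"
    using assms(1) by (auto simp: Omega_def)
  define R where "R s = Re (resolvent a c t0 s)" for s
  have m_eq: "m a c t = Re (laplace_w a c t)" for t
    by (rule m_eq_Re_laplace_w[OF assms(1)])
  have m_cont: "continuous_on A (m a c)" for A
    unfolding m_eq[abs_def] by (intro continuous_intros continuous_laplace_w)
  have res_cont: "continuous_on {0..1} (resolvent a c t0)"
    using assms(3) by (intro continuous_resolvent) simp
  have R_cont: "continuous_on {0..1} R"
    unfolding R_def[abs_def] by (intro continuous_intros res_cont)
  have volterra: "exp (s * t0) * R s = 1 - integral {0..t0} (\<lambda>u. exp (s * u) * m a c u)"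
    if "s \<in> {0..1}" for s
  proof -
    have Re_exp_mult: "Re (exp (of_real x) * z) = exp x * Re z" for x z
      by (simp add: Re_exp Im_exp)
    have "exp (s * t0) * R s = Re (exp (of_real (s * t0)) * resolvent a c t0 s)"
      unfolding R_def Re_exp_mult ..
    also have "\<dots> = 1 - Re (integral {0..t0} (\<lambda>u. exp (of_real (s * u)) * laplace_w a c u))"
      using assms(3) by (subst resolvent_Volterra[OF that]) simp_all
    also have "Re (integral {0..t0} (\<lambda>u. exp (of_real (s * u)) * laplace_w a c u)) =
        integral {0..t0} (\<lambda>u. exp (s * u) * m a c u)"
      by (subst Re_integral, intro continuous_intros continuous_laplace_w) (simp only: Re_exp_mult m_eq)
    finally show ?thesis .
  qed
  have decr: "exp (s' * t0) * R s' < exp (s * t0) * R s" if s: "0 \<le> s" "s < s'" "s' \<le> 1" for s s'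
  proof -
    let ?A = "\<lambda>s. integral {0..t0} (\<lambda>u. exp (s * u) * m a c u)"
    let ?d = "\<lambda>u. (exp (s' * u) - exp (s * u)) * m a c u"
    have d_cont: "continuous_on {0..t0} ?d"
      by (intro continuous_intros m_cont)
    have d_nonneg: "?d u \<ge> 0" if "u \<in> {0..t0}" for u
      using that s assms(2)[of u] by (intro mult_nonneg_nonneg) (auto intro: mult_right_mono)
    have diff: "?A s' - ?A s = integral {0..t0} ?d"
      by (subst integral_diff[symmetric])
        (auto intro!: integrable_continuous_real continuous_intros m_cont simp: left_diff_distrib)
    \<comment> \<open>Otherwise \<open>m a c\<close> vanishes on \<open>(0, t0]\<close>, hence at \<open>0\<close>, where its value is \<open>q1 a c > 0\<close>.\<close>
    have "integral {0..t0} ?d \<noteq> 0"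
    proof
      assume "integral {0..t0} ?d = 0"
      then have d0: "?d u = 0" if "u \<in> {0..t0}" for u
        using integral_eq_0_iff[OF d_cont assms(3) d_nonneg] that by blast
      have m0: "m a c u = 0" if "u \<in> {0<..t0}" for u
        using d0[of u] that s by auto
      have "(\<lambda>n. t0 * offset n) \<longlonglongrightarrow> t0 * 0" by (intro tendsto_intros offset_tendsto)
      then have "(\<lambda>n. m a c (t0 * offset n)) \<longlonglongrightarrow> m a c (t0 * 0)"
        by (rule continuous_on_tendsto_compose[OF m_cont[of UNIV]]) auto
      moreover have "m a c (t0 * offset n) = 0" for n
        using assms(3) offset_bounds[of n] by (intro m0) (auto simp: mult_le_cancel_left1)
      ultimately have "m a c 0 = 0" by (simp add: LIMSEQ_const_iff)
      moreover have "m a c 0 = a / 2 + c" by (simp add: m_def D_def q1_def)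
      ultimately show False using a c by linarith
    qed
    moreover have "integral {0..t0} ?d \<ge> 0"
      using d_nonneg by (intro integral_nonneg integrable_continuous_real d_cont) auto
    ultimately have "?A s < ?A s'" using diff by linarith
    then show ?thesis using volterra[of s] volterra[of s'] s by simp
  qed
  have Re_int: "Re (integral {0..1} (resolvent a c t0)) = integral {0..1} R"
    unfolding R_def[abs_def] by (rule Re_integral[OF res_cont])
  have "Re (of_real t0 * laplace_w a c t0) = a * integral {0..1} R + c * R 0 - (a + c) * R 1"
    unfolding laplace_w_resolvent_identity by (simp add: Re_int flip: R_def)
  moreover have "Re (of_real t0 * laplace_w a c t0) = 0"
    using m_eq[of t0] assms(4) by simp
  ultimately have balance: "a * integral {0..1} R + c * R 0 = (a + c) * R 1" by simp
  note signs = sign_of_moments[OF a c(1) assms(3) R_cont decr balance]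

  have "((\<lambda>x. Re (laplace_w x c t0)) has_real_derivative
      Re (integral {0..1} (\<lambda>s. of_real s * resolvent a c t0 s))) (at a)"
    unfolding has_real_derivative_iff_has_vector_derivative
    by (rule bounded_linear.has_vector_derivative[OF bounded_linear_Re laplace_w_derivative_a])
  then have "((\<lambda>x. m x c t0) has_real_derivative
      Re (integral {0..1} (\<lambda>s. of_real s * resolvent a c t0 s))) (at a)"
    by (rule has_field_derivative_transform_within_open[where S = "{0<..<3 - c}"])
      (use a c ac in \<open>auto simp: m_eq_Re_laplace_w Omega_def\<close>)
  moreover have "Re (integral {0..1} (\<lambda>s. of_real s * resolvent a c t0 s)) = integral {0..1} (\<lambda>s. s * R s)"
    by (subst Re_integral, intro continuous_intros res_cont) (simp add: R_def)
  ultimately have da: "((\<lambda>x. m x c t0) has_real_derivative integral {0..1} (\<lambda>s. s * R s)) (at a)"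
    by simp

  have dc0: "((\<lambda>y. Re (laplace_w a y t0)) has_real_derivative integral {0..1} R) (at c)"
    unfolding has_real_derivative_iff_has_vector_derivative Re_int[symmetric]
    by (rule bounded_linear.has_vector_derivative[OF bounded_linear_Re laplace_w_derivative_c])
  have dc: "((\<lambda>y. m a y t0) has_real_derivative integral {0..1} R) (if c = 0 then at_right 0 else at c)"
  proof (cases "c = 0")
    case True
    have "((\<lambda>y. m a y t0) has_real_derivative integral {0..1} R) (at 0 within {0..})"
    proof (rule has_field_derivative_transform_within)
      show "((\<lambda>y. Re (laplace_w a y t0)) has_real_derivative integral {0..1} R) (at 0 within {0..})"
        using dc0 True by (simp add: has_field_derivative_at_within)
      show "0 < min 1 (3 - a)" using ac c by simp
      fix y :: real assume "y \<in> {0..}" "dist y 0 < min 1 (3 - a)"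
      then show "Re (laplace_w a y t0) = m a y t0"
        using a by (intro m_eq_Re_laplace_w[symmetric]) (auto simp: Omega_def)
    qed simp
    then show ?thesis using True by (auto intro: DERIV_subset)
  next
    case False
    have "((\<lambda>y. m a y t0) has_real_derivative integral {0..1} R) (at c)"
      by (rule has_field_derivative_transform_within_open[OF dc0, where S = "{0<..<min 1 (3 - a)}"])
        (use a c ac False in \<open>auto simp: m_eq_Re_laplace_w Omega_def\<close>)
    then show ?thesis using False by simp
  qed
  show ?thesis using da dc signs by blast
qed

end
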